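(* Every finite set of mutually orthogonal pure states of a multipartite quantum system admits conclusive local random authentication (conclusive LRA), whereas there exists a finite set of mutually orthogonal mixed states of a multipartite quantum system that does not admit conclusive LRA.
   Context: An $n$-partite system ($n\ge 2$) has Hilbert space $\bigotimes_{k=1}^n\mathbb{C}^{d_k}$, each tensor factor being held by a different spatially separated party $B_k$. A state is a density operator on this space (pure states $|\psi\rangle$ are identified with $|\psi\rangle\langle\psi|$); states $\rho,\sigma$ are orthogonal if $\operatorname{Tr}(\rho\sigma)=0$. LOCC has its standard meaning: a protocol with finitely many rounds of local quantum measurements by individual parties and classical communication among all of them; a POVM is LOCC-implementable if its outcome statistics are produced by such a protocol (including classical post-processing). Conclusive LRA: for a set $\mathcal{S}=\{\rho_1,\dots,\rho_N\}$ of mutually orthogonal states, the question $\mathcal{Q}_k$ is "is the shared (unknown) state $\rho_k$ or not?"; the protocol may depend on $k$. The question $\mathcal{Q}_k$ can be conclusively answered with nonzero probability if there is an LOCC-implementable POVM $\{M_{\rm yes},M_{\rm no},M_?\}$ (depending on $k$) which never gives a wrong answer, i.e. $\operatorname{Tr}(M_{\rm yes}\rho_j)=0$ for all $j\ne k$ and $\operatorname{Tr}(M_{\rm no}\rho_k)=0$, and which gives a conclusive answer ("yes" or "no") with nonzero probability when the shared state is drawn uniformly from $\mathcal{S}$, i.e. $\frac1N\sum_{j}\operatorname{Tr}[(M_{\rm yes}+M_{\rm no})\rho_j]>0$. The set $\mathcal{S}$ admits conclusive LRA if every question $\mathcal{Q}_1,\dots,\mathcal{Q}_N$ can be conclusively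 answered with nonzero probability. *)

theory Defs
  imports "Jordan_Normal_Form.Schur_Decomposition"
begin

text \<open>
  A system is given by the list \<open>ds\<close> of its local dimensions. Its Hilbert space is
  \<open>carrier_vec (prod_list ds)\<close>, where basis vectors are numbered in the usual
  Kronecker order (the first party is the most significant digit).
  Inequalities between complex numbers are those of \<^theory>\<open>HOL-Library.Complex_Order\<close>:
  \<open>0 \<le> z\<close> and \<open>0 < z\<close> say in particular that \<open>z\<close> is real.
\<close>

definition multipartite :: "nat list \<Rightarrow> bool" where
  "multipartite ds \<longleftrightarrow> length ds \<ge> 2 \<and> (\<forall>d \<in> set ds. d > 0)"

definition tr :: "complex mat \<Rightarrow> complex" where
  "tr A = (\<Sum>i < dim_row A. A $$ (i, i))"

definition kron :: "complex mat \<Rightarrow> complex mat \<Rightarrow> complex mat" where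
  "kron A B = mat (dim_row A * dim_row B) (dim_col A * dim_col B)
     (\<lambda>(i, j). A $$ (i div dim_row B, j div dim_col B) * B $$ (i mod dim_row B, j mod dim_col B))"

definition positive_op :: "nat \<Rightarrow> complex mat \<Rightarrow> bool" where
  "positive_op D A \<longleftrightarrow> A \<in> carrier_mat D D \<and> (\<forall>v \<in> carrier_vec D. 0 \<le> (A *\<^sub>v v) \<bullet>c v)"


subsection \<open>States\<close>

definition density_op :: "nat list \<Rightarrow> complex mat \<Rightarrow> bool" where
  "density_op ds \<rho> \<longleftrightarrow> positive_op (prod_list ds) \<rho> \<and> tr \<rho> = 1"

definition ket_bra :: "complex vec \<Rightarrow> complex mat" where
  "ket_bra \<psi> = mat (dim_vec \<psi>) (dim_vec \<psi>) (\<lambda>(i, j). \<psi> $ i * conjugate (\<psi> $ j))"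

definition pure_state :: "nat list \<Rightarrow> complex mat \<Rightarrow> bool" where
  "pure_state ds \<rho> \<longleftrightarrow> (\<exists>\<psi> \<in> carrier_vec (prod_list ds). \<psi> \<bullet>c \<psi> = 1 \<and> \<rho> = ket_bra \<psi>)"

definition mixed_state :: "nat list \<Rightarrow> complex mat \<Rightarrow> bool" where
  "mixed_state ds \<rho> \<longleftrightarrow> density_op ds \<rho> \<and> \<not> pure_state ds \<rho>"

definition mutually_orthogonal :: "complex mat set \<Rightarrow> bool" where
  "mutually_orthogonal S \<longleftrightarrow> (\<forall>\<rho> \<in> S. \<forall>\<sigma> \<in> S. \<rho> \<noteq> \<sigma> \<longrightarrow> tr (\<rho> * \<sigma>) = 0)"


subsection \<open>LOCC protocols\<close>

text \<open>
  In \<open>Measure k Ks next\<close> party \<open>k\<close> measures with the Kraus operators \<open>Ks\<close>; the result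
  \<open>i < length Ks\<close> is announced to all parties, who go on with \<open>next i\<close>. Since \<open>next i\<close> depends
  on the whole history, all adaptive finite-round protocols arise in this way. Operators in \<open>Ks\<close>
  may change the dimension of the factor of party \<open>k\<close> (local ancillas, discarded subsystems).
  Operators after which the protocol goes on identically model results that are
  not recorded, distinct branches may end in the same output (deterministic post-processing), and
  Kraus operators that are multiples of the identity provide classical randomness.
\<close>

datatype 'o protocol =
    Output 'o
  | Measure nat "complex mat list" "nat \<Rightarrow> 'o protocol"

definition kraus_family :: "nat \<Rightarrow> complex mat list \<Rightarrow> bool" where
  "kraus_family d Ks \<longleftrightarrow>
     (\<forall>K \<in> set Ks. dim_col K = d \<and> dim_row K > 0) \<and>
     foldr (+) (map (\<lambda>K. mat_adjoint K * K) Ks) (0\<^sub>m d d) = 1\<^sub>m d"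

definition local_op :: "nat list \<Rightarrow> nat \<Rightarrow> complex mat \<Rightarrow> complex mat" where
  "local_op ds k K =
     kron (1\<^sub>m (prod_list (take k ds))) (kron K (1\<^sub>m (prod_list (drop (Suc k) ds))))"

primrec valid_protocol :: "'o protocol \<Rightarrow> nat list \<Rightarrow> bool" where
  "valid_protocol (Output x) ds \<longleftrightarrow> True"
| "valid_protocol (Measure k Ks next) ds \<longleftrightarrow>
     k < length ds \<and> kraus_family (ds ! k) Ks \<and>
     (\<forall>i < length Ks. valid_protocol (next i) (ds[k := dim_row (Ks ! i)]))"

text \<open>
  The probability of output \<open>x\<close> on input \<open>\<rho>\<close>. States after a measurement are not renormalized, so
  the trace at a leaf is the probability of reaching it.
\<close>

primrec outcome_prob :: "'o protocol \<Rightarrow> nat list \<Rightarrow> complex mat \<Rightarrow> 'o \<Rightarrow> complex" where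
  "outcome_prob (Output y) ds \<rho> x = (if x = y then tr \<rho> else 0)"
| "outcome_prob (Measure k Ks next) ds \<rho> x =
     (\<Sum>i < length Ks. outcome_prob (next i) (ds[k := dim_row (Ks ! i)])
        (local_op ds k (Ks ! i) * \<rho> * mat_adjoint (local_op ds k (Ks ! i))) x)"

definition locc_implementable :: "nat list \<Rightarrow> ('o \<Rightarrow> complex mat) \<Rightarrow> bool" where
  "locc_implementable ds M \<longleftrightarrow>
     (\<exists>P. valid_protocol P ds \<and>
        (\<forall>\<rho> x. density_op ds \<rho> \<longrightarrow> outcome_prob P ds \<rho> x = tr (M x * \<rho>)))"


subsection \<open>Conclusive local random authentication\<close>

datatype answer = Yes | No | Inconclusive

definition answer_povm :: "nat list \<Rightarrow> (answer \<Rightarrow> complex mat) \<Rightarrow> bool" where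
  "answer_povm ds M \<longleftrightarrow>
     (\<forall>x. positive_op (prod_list ds) (M x)) \<and>
     M Yes + M No + M Inconclusive = 1\<^sub>m (prod_list ds)"

definition conclusively_answerable :: "nat list \<Rightarrow> complex mat set \<Rightarrow> complex mat \<Rightarrow> bool" where
  "conclusively_answerable ds S \<rho> \<longleftrightarrow>
     (\<exists>M. answer_povm ds M \<and> locc_implementable ds M \<and>
        (\<forall>\<sigma> \<in> S - {\<rho>}. tr (M Yes * \<sigma>) = 0) \<and> tr (M No * \<rho>) = 0 \<and>
        1 / of_nat (card S) * (\<Sum>\<sigma> \<in> S. tr ((M Yes + M No) * \<sigma>)) > 0)"

definition conclusive_LRA :: "nat list \<Rightarrow> complex mat set \<Rightarrow> bool" where
  "conclusive_LRA ds S \<longleftrightarrow> (\<forall>\<rho> \<in> S. conclusively_answerable ds S \<rho>)"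

end

(*
  Pure states. Orthogonal states psi and chi are in particular not proportional. The parties take
  turns to project onto a unit vector phi, giving up if the projection fails; phi can be chosen such
  that the contraction of chi with phi is still not a multiple of the contraction of psi. When all
  factors are contracted only scalars remain, so psi has been mapped to 0 and chi has not: the event
  that all projections succeed has probability 0 on psi and positive probability on chi, and it
  answers the question about psi with No.

  Mixed states. On three qubits take the normalized projectors onto two orthogonal four-dimensional
  subspaces neither of which contains a nonzero product vector; as each is the kernel of one of the
  two states, no nonzero product vector is annihilated by either of them. Every branch of an LOCC protocol acts by a tensor product of
  three local operators, whose rows are product vectors, so a branch of probability 0 on one of the
  two states is the zero operator and never occurs on the other state either.
*)

theory Submission
  imports Defs
begin

section \<open>Entrywise formulas, adjoints and traces\<close>

lemma mat_adjoint_eq: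
  "mat_adjoint A = mat (dim_col A) (dim_row A) (\<lambda>(i, j). cnj (A $$ (j, i)))"
  for A :: "complex mat"
  by (rule eq_matI) (auto simp: mat_adjoint_def mat_of_rows_def)

lemma dim_mat_adjoint [simp]:
  "dim_row (mat_adjoint A) = dim_col A" "dim_col (mat_adjoint A) = dim_row A"
  for A :: "complex mat"
  by (simp_all add: mat_adjoint_eq)

lemma mat_adjoint_carrier [simp]:
  "mat_adjoint A \<in> carrier_mat n m \<longleftrightarrow> A \<in> carrier_mat m n" for A :: "complex mat"
  unfolding carrier_mat_def by auto

lemma mat_adjoint_index [simp]:
  "i < dim_col A \<Longrightarrow> j < dim_row A \<Longrightarrow> mat_adjoint A $$ (i, j) = cnj (A $$ (j, i))"
  for A :: "complex mat"
  by (simp add: mat_adjoint_eq)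

lemma mult_mat_index:
  assumes "A \<in> carrier_mat n m" "B \<in> carrier_mat m p" "i < n" "j < p"
  shows "(A * B) $$ (i, j) = (\<Sum>k<m. A $$ (i, k) * B $$ (k, j))"
  using assms by (auto simp: scalar_prod_def lessThan_atLeast0 intro!: sum.cong)

lemma mult_mat_vec_index:
  assumes "A \<in> carrier_mat n m" "v \<in> carrier_vec m" "i < n"
  shows "(A *\<^sub>v v) $ i = (\<Sum>k<m. A $$ (i, k) * v $ k)"
  using assms by (auto simp: scalar_prod_def lessThan_atLeast0 intro!: sum.cong)

lemma cscalar_prod_eq:
  assumes "v \<in> carrier_vec n" "w \<in> carrier_vec n"
  shows "v \<bullet>c w = (\<Sum>k<n. v $ k * cnj (w $ k))"
  using assms by (auto simp: scalar_prod_def lessThan_atLeast0 intro!: sum.cong)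

lemma mat_adjoint_mult:
  fixes A B :: "complex mat"
  assumes "A \<in> carrier_mat n m" "B \<in> carrier_mat m p"
  shows "mat_adjoint (A * B) = mat_adjoint B * mat_adjoint A"
proof (rule eq_matI)
  fix i j
  assume "i < dim_row (mat_adjoint B * mat_adjoint A)" "j < dim_col (mat_adjoint B * mat_adjoint A)"
  then have ij: "i < p" "j < n" using assms by auto
  show "mat_adjoint (A * B) $$ (i, j) = (mat_adjoint B * mat_adjoint A) $$ (i, j)"
    using ij assms mult_mat_index[OF assms, of j i]
      mult_mat_index[of "mat_adjoint B" p m "mat_adjoint A" n i j]
    by (auto simp: mult.commute intro!: sum.cong)
qed (use assms in auto)

lemma cscalar_prod_adjoint:
  fixes A :: "complex mat"
  assumes "A \<in> carrier_mat n m" "v \<in> carrier_vec m" "w \<in> carrier_vec n"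
  shows "(A *\<^sub>v v) \<bullet>c w = v \<bullet>c (mat_adjoint A *\<^sub>v w)"
proof -
  have "(A *\<^sub>v v) \<bullet>c w = (\<Sum>i<n. (\<Sum>k<m. A $$ (i, k) * v $ k) * cnj (w $ i))"
    using assms by (simp add: cscalar_prod_eq[of _ n] mult_mat_vec_index[of A n m] del: index_mult_mat_vec)
  also have "\<dots> = (\<Sum>k<m. \<Sum>i<n. A $$ (i, k) * v $ k * cnj (w $ i))"
    by (subst sum.swap) (simp add: sum_distrib_right)
  also have "\<dots> = (\<Sum>k<m. v $ k * cnj (\<Sum>i<n. mat_adjoint A $$ (k, i) * w $ i))"
    using assms by (auto simp: sum_distrib_left mult_ac intro!: sum.cong)
  also have "\<dots> = v \<bullet>c (mat_adjoint A *\<^sub>v w)"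
    using assms by (simp add: cscalar_prod_eq[of _ m] mult_mat_vec_index[of _ m n] del: index_mult_mat_vec)
  finally show ?thesis .
qed

lemma tr_mult:
  assumes "A \<in> carrier_mat n m" "B \<in> carrier_mat m n"
  shows "tr (A * B) = (\<Sum>i<n. \<Sum>k<m. A $$ (i, k) * B $$ (k, i))"
  unfolding tr_def using assms
  by (auto simp: mult_mat_index[OF assms] simp del: index_mult_mat(1) intro!: sum.cong)

lemma tr_comm:
  assumes "A \<in> carrier_mat n m" "B \<in> carrier_mat m n"
  shows "tr (A * B) = tr (B * A)"
  unfolding tr_mult[OF assms] tr_mult[OF assms(2,1)]
  by (subst sum.swap) (simp add: mult.commute)

lemma tr_add:
  assumes "A \<in> carrier_mat n n" "B \<in> carrier_mat n n"
  shows "tr (A + B) = tr A + tr B"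
  using assms by (auto simp: tr_def sum.distrib)

lemma tr_add_mult:
  assumes "A \<in> carrier_mat n n" "B \<in> carrier_mat n n" "C \<in> carrier_mat n n"
  shows "tr ((A + B) * C) = tr (A * C) + tr (B * C)"
  using assms by (simp add: add_mult_distrib_mat[OF assms] tr_add[of _ n])

section \<open>Kronecker products\<close>

lemma dim_kron [simp]:
  "dim_row (kron A B) = dim_row A * dim_row B" "dim_col (kron A B) = dim_col A * dim_col B"
  by (simp_all add: kron_def)

lemma kron_carrier [simp]:
  "A \<in> carrier_mat m n \<Longrightarrow> B \<in> carrier_mat p q \<Longrightarrow> kron A B \<in> carrier_mat (m * p) (n * q)"
  unfolding carrier_mat_def by simp

lemma kron_index:
  "i < dim_row A * dim_row B \<Longrightarrow> j < dim_col A * dim_col B \<Longrightarrow> kron A B $$ (i, j) =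
    A $$ (i div dim_row B, j div dim_col B) * B $$ (i mod dim_row B, j mod dim_col B)"
  by (simp add: kron_def)

lemma less_mult_divmod:
  fixes i m n :: nat
  assumes "i < m * n"
  shows "i div n < m" "i mod n < n"
proof -
  show "i div n < m" using assms by (simp add: less_mult_imp_div_less)
  have "n > 0" using assms by (cases n) auto
  then show "i mod n < n" by simp
qed

text \<open>A Kronecker index \<open>k\<close> is the pair of digits \<open>k div n\<close> and
  \<open>k mod n\<close>. This splits the summation index in products with a Kronecker
  product.\<close>

lemma sum_divmod:
  fixes f :: "nat \<Rightarrow> nat \<Rightarrow> 'a :: comm_monoid_add"
  shows "(\<Sum>k<m * n. f (k div n) (k mod n)) = (\<Sum>i<m. \<Sum>j<n. f i j)"
proof (induction m)
  case (Suc m)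
  have "(\<Sum>k<Suc m * n. f (k div n) (k mod n)) =
      (\<Sum>k<m * n. f (k div n) (k mod n)) + (\<Sum>k = m * n..<m * n + n. f (k div n) (k mod n))"
    by (simp add: lessThan_atLeast0 sum.atLeastLessThan_concat add.commute)
  also have "(\<Sum>k = m * n..<m * n + n. f (k div n) (k mod n)) = (\<Sum>j<n. f m j)"
    using sum.shift_bounds_nat_ivl[of "\<lambda>k. f (k div n) (k mod n)" 0 "m * n" n]
    by (simp add: lessThan_atLeast0 add.commute)
  finally show ?case using Suc.IH by simp
qed simp

lemma kron_mult:
  assumes "A \<in> carrier_mat m n" "C \<in> carrier_mat n p" "B \<in> carrier_mat m' n'" "D \<in> carrier_mat n' p'"
  shows "kron A B * kron C D = kron (A * C) (B * D)"
proof (rule eq_matI)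
  fix i j assume "i < dim_row (kron (A * C) (B * D))" "j < dim_col (kron (A * C) (B * D))"
  then have i: "i < m * m'" and j: "j < p * p'" using assms by auto
  note b = less_mult_divmod[OF i] less_mult_divmod[OF j]
  have "(kron A B * kron C D) $$ (i, j) = (\<Sum>k<n * n'. kron A B $$ (i, k) * kron C D $$ (k, j))"
    using assms i j by (intro mult_mat_index) auto
  also have "\<dots> = (\<Sum>k<n * n'. (A $$ (i div m', k div n') * C $$ (k div n', j div p')) *
      (B $$ (i mod m', k mod n') * D $$ (k mod n', j mod p')))"
    using assms i j by (intro sum.cong) (auto simp: kron_index mult_ac)
  also have "\<dots> = (\<Sum>k<n. \<Sum>l<n'. (A $$ (i div m', k) * C $$ (k, j div p')) *
      (B $$ (i mod m', l) * D $$ (l, j mod p')))"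
    by (rule sum_divmod)
  also have "\<dots> = (\<Sum>k<n. A $$ (i div m', k) * C $$ (k, j div p')) *
      (\<Sum>l<n'. B $$ (i mod m', l) * D $$ (l, j mod p'))"
    by (rule sum_product[symmetric])
  also have "\<dots> = (A * C) $$ (i div m', j div p') * (B * D) $$ (i mod m', j mod p')"
    using mult_mat_index[OF assms(1,2) b(1,3)] mult_mat_index[OF assms(3,4) b(2,4)] by simp
  also have "\<dots> = kron (A * C) (B * D) $$ (i, j)"
    using assms i j by (simp add: kron_index)
  finally show "(kron A B * kron C D) $$ (i, j) = kron (A * C) (B * D) $$ (i, j)" .
qed (use assms in auto)

lemma kron_one_one: "kron (1\<^sub>m m) (1\<^sub>m n) = 1\<^sub>m (m * n)"
proof (rule eq_matI)
  fix i j assume "i < dim_row (1\<^sub>m (m * n))" "j < dim_col (1\<^sub>m (m * n))"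
  then have i: "i < m * n" and j: "j < m * n" by auto
  have "i = j \<longleftrightarrow> i div n = j div n \<and> i mod n = j mod n"
    by (metis div_mult_mod_eq)
  then show "kron (1\<^sub>m m) (1\<^sub>m n) $$ (i, j) = 1\<^sub>m (m * n) $$ (i, j)"
    using i j less_mult_divmod[OF i] less_mult_divmod[OF j] by (auto simp: kron_index)
qed auto

lemma kron_one_left: "kron (1\<^sub>m 1) A = A"
  by (rule eq_matI) (auto simp: kron_index)

lemma kron_one_right: "kron A (1\<^sub>m 1) = A"
  by (rule eq_matI) (auto simp: kron_index)

lemma kron_assoc: "kron (kron A B) C = kron A (kron B C)"
proof (rule eq_matI)
  fix i j assume "i < dim_row (kron A (kron B C))" "j < dim_col (kron A (kron B C))"
  then have i: "i < dim_row A * dim_row B * dim_row C" "i < dim_row A * (dim_row B * dim_row C)"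
    and j: "j < dim_col A * dim_col B * dim_col C" "j < dim_col A * (dim_col B * dim_col C)"
    by (auto simp: mult_ac)
  \<comment> \<open>Both nestings read off the same three mixed-radix digits of an index. For
    \<open>c = 0\<close> the default values of \<open>div\<close> and \<open>mod\<close> agree as
    well.\<close>
  have divmod: "k div c mod b = k mod (b * c) div c" "k mod (b * c) mod c = k mod c"
    "k div c div b = k div (b * c)" for k b c :: nat
    by (cases "c = 0") (simp_all add: mult.commute[of b c] mod_mult2_eq div_mult2_eq)
  show "kron (kron A B) C $$ (i, j) = kron A (kron B C) $$ (i, j)"
    using less_mult_divmod[OF i(1)] less_mult_divmod[OF i(2)]
      less_mult_divmod[OF j(1)] less_mult_divmod[OF j(2)] i j
    by (simp add: kron_index divmod mult.assoc)
qed (auto simp: mult_ac)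

lemma kron_adjoint: "mat_adjoint (kron A B) = kron (mat_adjoint A) (mat_adjoint B)"
proof (rule eq_matI)
  fix i j
  assume "i < dim_row (kron (mat_adjoint A) (mat_adjoint B))"
    "j < dim_col (kron (mat_adjoint A) (mat_adjoint B))"
  then have i: "i < dim_col A * dim_col B" and j: "j < dim_row A * dim_row B" by auto
  show "mat_adjoint (kron A B) $$ (i, j) = kron (mat_adjoint A) (mat_adjoint B) $$ (i, j)"
    using i j less_mult_divmod[OF i] less_mult_divmod[OF j] by (simp add: kron_index)
qed auto

lemma kron_add_left:
  assumes "A \<in> carrier_mat m n" "B \<in> carrier_mat m n"
  shows "kron (A + B) C = kron A C + kron B C"
proof (rule eq_matI)
  fix i j assume "i < dim_row (kron A C + kron B C)" "j < dim_col (kron A C + kron B C)"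
  then have i: "i < m * dim_row C" and j: "j < n * dim_col C" using assms by auto
  show "kron (A + B) C $$ (i, j) = (kron A C + kron B C) $$ (i, j)"
    using i j less_mult_divmod[OF i] less_mult_divmod[OF j] assms
    by (simp add: kron_index distrib_right)
qed (use assms in auto)

lemma kron_add_right:
  assumes "A \<in> carrier_mat m n" "B \<in> carrier_mat m n"
  shows "kron C (A + B) = kron C A + kron C B"
proof (rule eq_matI)
  fix i j assume "i < dim_row (kron C A + kron C B)" "j < dim_col (kron C A + kron C B)"
  then have i: "i < dim_row C * m" and j: "j < dim_col C * n" using assms by auto
  show "kron C (A + B) $$ (i, j) = (kron C A + kron C B) $$ (i, j)"
    using i j less_mult_divmod[OF i] less_mult_divmod[OF j] assms
    by (simp add: kron_index distrib_left)
qed (use assms in auto)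

section \<open>Local operators\<close>

lemma prod_list_split:
  "k < length ds \<Longrightarrow> prod_list (take k ds) * (ds ! k * prod_list (drop (Suc k) ds)) = prod_list ds"
  for ds :: "nat list"
  by (metis id_take_nth_drop prod_list.append prod_list.Cons)

lemma prod_list_update_split:
  "k < length ds \<Longrightarrow>
    prod_list (ds[k := r]) = prod_list (take k ds) * (r * prod_list (drop (Suc k) ds))"
  for ds :: "nat list"
  by (simp add: upd_conv_take_nth_drop)

lemma local_op_carrier:
  assumes "k < length ds" "dim_col K = ds ! k"
  shows "local_op ds k K \<in> carrier_mat (prod_list (ds[k := dim_row K])) (prod_list ds)"
proof -
  have "local_op ds k K \<in> carrier_mat
      (prod_list (take k ds) * (dim_row K * prod_list (drop (Suc k) ds)))
      (prod_list (take k ds) * (ds ! k * prod_list (drop (Suc k) ds)))"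
    unfolding local_op_def using assms(2) by (intro kron_carrier) auto
  then show ?thesis
    unfolding prod_list_update_split[OF assms(1)] prod_list_split[OF assms(1)] .
qed

lemma local_op_one:
  "k < length ds \<Longrightarrow> local_op ds k (1\<^sub>m (ds ! k)) = 1\<^sub>m (prod_list ds)"
  by (simp add: local_op_def kron_one_one prod_list_split)

lemma local_op_add:
  assumes "A \<in> carrier_mat m n" "B \<in> carrier_mat m n"
  shows "local_op ds k (A + B) = local_op ds k A + local_op ds k B"
proof -
  let ?R = "1\<^sub>m (prod_list (drop (Suc k) ds)) :: complex mat"
  have "kron A ?R \<in> carrier_mat (m * dim_row ?R) (n * dim_row ?R)"
    "kron B ?R \<in> carrier_mat (m * dim_row ?R) (n * dim_row ?R)"
    using assms by (auto intro!: kron_carrier)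
  then show ?thesis
    unfolding local_op_def kron_add_left[OF assms] by (rule kron_add_right)
qed

text \<open>The identities on the other factors multiply to themselves, so by
  \<open>kron_mult\<close> only the factor of party \<open>k\<close> changes. Hence completeness of
  a Kraus family on one factor carries over to the whole space.\<close>

lemma local_op_adjoint_mult:
  "mat_adjoint (local_op ds k K) * local_op ds k K = local_op ds k (mat_adjoint K * K)"
proof -
  let ?L = "1\<^sub>m (prod_list (take k ds)) :: complex mat"
  let ?R = "1\<^sub>m (prod_list (drop (Suc k) ds)) :: complex mat"
  have one: "mat_adjoint (1\<^sub>m n) = (1\<^sub>m n :: complex mat)" for n
    by (rule eq_matI) auto
  have K: "K \<in> carrier_mat (dim_row K) (dim_col K)" by simp
  then have K': "mat_adjoint K \<in> carrier_mat (dim_col K) (dim_row K)" by simp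
  show ?thesis
    unfolding local_op_def kron_adjoint one
    by (subst kron_mult[OF one_carrier_mat one_carrier_mat kron_carrier[OF K' one_carrier_mat]
          kron_carrier[OF K one_carrier_mat]],
        subst kron_mult[OF K' K one_carrier_mat one_carrier_mat]) simp
qed

section \<open>Rank-one operators and positivity\<close>

lemma ket_bra_carrier [simp]: "\<psi> \<in> carrier_vec n \<Longrightarrow> ket_bra \<psi> \<in> carrier_mat n n"
  by (auto simp: ket_bra_def)

text \<open>Allows a branch of a protocol on a pure state to be followed on the level of
  unnormalized vectors.\<close>

lemma conj_ket_bra:
  assumes "L \<in> carrier_mat m n" "\<psi> \<in> carrier_vec n"
  shows "L * ket_bra \<psi> * mat_adjoint L = ket_bra (L *\<^sub>v \<psi>)"
proof (rule eq_matI)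
  fix i j assume "i < dim_row (ket_bra (L *\<^sub>v \<psi>))" "j < dim_col (ket_bra (L *\<^sub>v \<psi>))"
  then have ij: "i < m" "j < m" using assms by (auto simp: ket_bra_def)
  have "(L * ket_bra \<psi> * mat_adjoint L) $$ (i, j) =
      (\<Sum>l<n. (L * ket_bra \<psi>) $$ (i, l) * mat_adjoint L $$ (l, j))"
    using assms ij by (intro mult_mat_index) auto
  also have "\<dots> = (\<Sum>l<n. (\<Sum>k<n. L $$ (i, k) * ket_bra \<psi> $$ (k, l)) * cnj (L $$ (j, l)))"
    using assms ij by (intro sum.cong) (simp_all add: mult_mat_index[of L m n _ n] del: index_mult_mat(1))
  also have "\<dots> = (\<Sum>l<n. (\<Sum>k<n. L $$ (i, k) * \<psi> $ k) * cnj (L $$ (j, l) * \<psi> $ l))"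
    using assms by (intro sum.cong)
      (auto simp: ket_bra_def sum_distrib_left sum_distrib_right mult_ac intro!: sum.cong)
  also have "\<dots> = (L *\<^sub>v \<psi>) $ i * cnj ((L *\<^sub>v \<psi>) $ j)"
    using assms ij by (simp add: mult_mat_vec_index[of L m n] sum_distrib_left del: index_mult_mat_vec)
  finally show "(L * ket_bra \<psi> * mat_adjoint L) $$ (i, j) = ket_bra (L *\<^sub>v \<psi>) $$ (i, j)"
    using assms ij by (simp add: ket_bra_def)
qed (use assms in \<open>auto simp: ket_bra_def\<close>)

lemma tr_ket_bra: "tr (ket_bra \<psi>) = \<psi> \<bullet>c \<psi>"
  by (simp add: tr_def ket_bra_def cscalar_prod_eq[of _ "dim_vec \<psi>"])

lemma tr_mult_ket_bra:
  assumes "E \<in> carrier_mat n n" "\<psi> \<in> carrier_vec n"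
  shows "tr (E * ket_bra \<psi>) = (E *\<^sub>v \<psi>) \<bullet>c \<psi>"
proof -
  have "tr (E * ket_bra \<psi>) = (\<Sum>i<n. \<Sum>k<n. E $$ (i, k) * ket_bra \<psi> $$ (k, i))"
    using assms by (intro tr_mult) auto
  also have "\<dots> = (E *\<^sub>v \<psi>) \<bullet>c \<psi>"
    using assms by (auto simp: cscalar_prod_eq[of _ n] mult_mat_vec_index[of E n n] ket_bra_def
        sum_distrib_left sum_distrib_right mult_ac simp del: index_mult_mat_vec intro!: sum.cong)
  finally show ?thesis .
qed

lemma ket_bra_mult_vec:
  assumes "\<psi> \<in> carrier_vec n" "v \<in> carrier_vec n"
  shows "ket_bra \<psi> *\<^sub>v v = (v \<bullet>c \<psi>) \<cdot>\<^sub>v \<psi>"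
proof (rule eq_vecI)
  fix i assume "i < dim_vec ((v \<bullet>c \<psi>) \<cdot>\<^sub>v \<psi>)"
  then have i: "i < n" using assms by simp
  have "(ket_bra \<psi> *\<^sub>v v) $ i = (\<Sum>k<n. ket_bra \<psi> $$ (i, k) * v $ k)"
    using assms i by (intro mult_mat_vec_index) auto
  also have "\<dots> = ((v \<bullet>c \<psi>) \<cdot>\<^sub>v \<psi>) $ i"
    using assms i by (auto simp: ket_bra_def cscalar_prod_eq[of _ n] sum_distrib_left
        sum_distrib_right mult_ac intro!: sum.cong)
  finally show "(ket_bra \<psi> *\<^sub>v v) $ i = ((v \<bullet>c \<psi>) \<cdot>\<^sub>v \<psi>) $ i" .
qed (use assms in \<open>auto simp: ket_bra_def\<close>)

lemma cscalar_prod_commute: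
  assumes "v \<in> carrier_vec n" "w \<in> carrier_vec n"
  shows "w \<bullet>c v = cnj (v \<bullet>c w)"
  using assms by (simp add: cscalar_prod_eq[of _ n] mult.commute)

text \<open>The value is the squared modulus of the inner product, so trace orthogonality of pure
  states is orthogonality of their vectors.\<close>

lemma tr_ket_bra_mult_ket_bra:
  assumes "\<psi> \<in> carrier_vec n" "\<chi> \<in> carrier_vec n"
  shows "tr (ket_bra \<psi> * ket_bra \<chi>) = (\<chi> \<bullet>c \<psi>) * cnj (\<chi> \<bullet>c \<psi>)"
  using assms cscalar_prod_commute[OF assms(2,1)]
  by (simp add: tr_mult_ket_bra[of _ n] ket_bra_mult_vec[of _ n])

lemma positive_op_ket_bra:
  assumes "\<psi> \<in> carrier_vec n"
  shows "positive_op n (ket_bra \<psi>)"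
  unfolding positive_op_def
proof (intro conjI ballI)
  fix v :: "complex vec" assume v: "v \<in> carrier_vec n"
  have "(ket_bra \<psi> *\<^sub>v v) \<bullet>c v = (v \<bullet>c \<psi>) * cnj (v \<bullet>c \<psi>)"
    using assms v cscalar_prod_commute[OF v assms] by (simp add: ket_bra_mult_vec[of _ n])
  also have "\<dots> \<ge> 0" by (metis conjugate_square_positive conjugate_complex_def)
  finally show "0 \<le> (ket_bra \<psi> *\<^sub>v v) \<bullet>c v" .
qed (use assms in simp)

text \<open>Moving \<open>L\<close> to the other side of the inner product turns the form at
  \<open>v\<close> into the form of \<open>\<rho>\<close> at
  \<open>mat_adjoint L *\<^sub>v v\<close>.\<close>

lemma positive_op_conj:
  assumes "positive_op n \<rho>" "L \<in> carrier_mat m n"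
  shows "positive_op m (L * \<rho> * mat_adjoint L)"
  unfolding positive_op_def
proof (intro conjI ballI)
  have \<rho>: "\<rho> \<in> carrier_mat n n" using assms(1) by (simp add: positive_op_def)
  then show "L * \<rho> * mat_adjoint L \<in> carrier_mat m m" using assms(2) by simp
  fix v :: "complex vec" assume v: "v \<in> carrier_vec m"
  let ?w = "mat_adjoint L *\<^sub>v v"
  have L': "mat_adjoint L \<in> carrier_mat n m" using assms(2) by simp
  have w: "?w \<in> carrier_vec n" using L' v by (rule mult_mat_vec_carrier)
  have "(L * \<rho> * mat_adjoint L *\<^sub>v v) \<bullet>c v = (L *\<^sub>v (\<rho> *\<^sub>v ?w)) \<bullet>c v"
    using \<rho> assms(2) v L' w
      assoc_mult_mat_vec[OF mult_carrier_mat[OF assms(2) \<rho>] L' v]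
      assoc_mult_mat_vec[OF assms(2) \<rho> w] by simp
  also have "\<dots> = (\<rho> *\<^sub>v ?w) \<bullet>c ?w"
    using assms(2) mult_mat_vec_carrier[OF \<rho> w] v by (rule cscalar_prod_adjoint)
  also have "\<dots> \<ge> 0" using assms(1) w by (simp add: positive_op_def)
  finally show "0 \<le> (L * \<rho> * mat_adjoint L *\<^sub>v v) \<bullet>c v" .
qed

lemma positive_op_tr:
  assumes "positive_op n \<rho>"
  shows "0 \<le> tr \<rho>"
proof -
  have \<rho>: "\<rho> \<in> carrier_mat n n" using assms by (simp add: positive_op_def)
  have "0 \<le> \<rho> $$ (i, i)" if i: "i < n" for i
  proof -
    have "(\<rho> *\<^sub>v unit_vec n i) \<bullet>c unit_vec n i = \<rho> $$ (i, i)"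
      using \<rho> i by (simp add: cscalar_prod_eq[of _ n] mult_mat_vec_index[of \<rho> n n] unit_vec_def
          if_distrib[of cnj] if_distrib[of "(*) _"] cong: if_cong del: index_mult_mat_vec)
    moreover have "0 \<le> (\<rho> *\<^sub>v unit_vec n i) \<bullet>c unit_vec n i"
      using assms by (simp add: positive_op_def)
    ultimately show ?thesis by simp
  qed
  then show ?thesis unfolding tr_def using \<rho> by (intro sum_nonneg) auto
qed

section \<open>The POVM of a protocol\<close>

lemma kraus_familyD:
  "kraus_family d Ks \<Longrightarrow> i < length Ks \<Longrightarrow> dim_col (Ks ! i) = d"
  by (simp add: kraus_family_def)

text \<open>Each branch conjugates \<open>\<rho>\<close> by a local operator, which preserves
  positivity, and a leaf takes the trace. Besides positivity of the effects, this ensures that a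
  total probability 0 forces every branch to have probability 0.\<close>

lemma outcome_prob_nonneg:
  "valid_protocol P ds \<Longrightarrow> positive_op (prod_list ds) \<rho> \<Longrightarrow> 0 \<le> outcome_prob P ds \<rho> x"
proof (induction P arbitrary: ds \<rho>)
  case (Output y)
  then show ?case by (simp add: positive_op_tr)
next
  case (Measure k Ks nxt)
  show ?case unfolding outcome_prob.simps
  proof (rule sum_nonneg)
    fix i assume "i \<in> {..<length Ks}"
    then have i: "i < length Ks" by simp
    have L: "local_op ds k (Ks ! i) \<in> carrier_mat (prod_list (ds[k := dim_row (Ks ! i)])) (prod_list ds)"
      using Measure.prems i by (intro local_op_carrier) (auto simp: kraus_familyD)
    show "0 \<le> outcome_prob (nxt i) (ds[k := dim_row (Ks ! i)])
        (local_op ds k (Ks ! i) * \<rho> * mat_adjoint (local_op ds k (Ks ! i))) x"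
      using Measure.prems i positive_op_conj[OF Measure.prems(2) L] by (intro Measure.IH) auto
  qed
qed

text \<open>Linearity of \<open>local_op ds k\<close> and of the trace, along the
  \<open>foldr\<close> in which \<open>kraus_family\<close> expresses completeness.\<close>

lemma tr_local_op_foldr:
  assumes "\<And>K. K \<in> set Ks \<Longrightarrow> f K \<in> carrier_mat (ds ! k) (ds ! k)" "k < length ds"
    "\<rho> \<in> carrier_mat (prod_list ds) (prod_list ds)"
  shows "tr (local_op ds k (foldr (+) (map f Ks) (0\<^sub>m (ds ! k) (ds ! k))) * \<rho>) =
    (\<Sum>i<length Ks. tr (local_op ds k (f (Ks ! i)) * \<rho>))"
  using assms(1)
proof (induction Ks)
  case Nil
  let ?Z = "local_op ds k (0\<^sub>m (ds ! k) (ds ! k))"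
  have Z: "?Z \<in> carrier_mat (prod_list ds) (prod_list ds)"
    using local_op_carrier[OF assms(2), of "0\<^sub>m (ds ! k) (ds ! k)"] assms(2) by simp
  \<comment> \<open>Additivity alone shows that the zero operator contributes nothing: the trace
    \<open>t\<close> in question satisfies \<open>t + t = t\<close>.\<close>
  have "?Z + ?Z = ?Z"
    by (subst local_op_add[symmetric, OF zero_carrier_mat zero_carrier_mat]) simp
  then have "tr (?Z * \<rho>) + tr (?Z * \<rho>) = tr (?Z * \<rho>)"
    using tr_add_mult[OF Z Z assms(3)] by simp
  then show ?case by simp
next
  case (Cons K Ks)
  let ?F = "foldr (+) (map f Ks) (0\<^sub>m (ds ! k) (ds ! k))"
  have "foldr (+) (map f Xs) (0\<^sub>m (ds ! k) (ds ! k)) \<in> carrier_mat (ds ! k) (ds ! k)"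
    if "set Xs \<subseteq> set Ks" for Xs
    using that Cons.prems by (induction Xs) simp_all
  then have F: "?F \<in> carrier_mat (ds ! k) (ds ! k)" by simp
  have K: "f K \<in> carrier_mat (ds ! k) (ds ! k)" using Cons.prems by simp
  have c: "local_op ds k A \<in> carrier_mat (prod_list ds) (prod_list ds)"
    if "A \<in> carrier_mat (ds ! k) (ds ! k)" for A
    using local_op_carrier[OF assms(2), of A] assms(2) that by simp
  have "tr (local_op ds k (f K + ?F) * \<rho>) = tr (local_op ds k (f K) * \<rho>) + tr (local_op ds k ?F * \<rho>)"
    unfolding local_op_add[OF K F] by (rule tr_add_mult[OF c[OF K] c[OF F] assms(3)])
  then show ?case using Cons by (simp add: sum.lessThan_Suc_shift del: sum.lessThan_Suc)
qed

text \<open>Cyclicity of the trace brings the two local operators together, and completeness makes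
  their products sum to the identity.\<close>

lemma sum_tr_kraus:
  assumes "kraus_family (ds ! k) Ks" "k < length ds"
    "\<rho> \<in> carrier_mat (prod_list ds) (prod_list ds)"
  shows "(\<Sum>i<length Ks. tr (local_op ds k (Ks ! i) * \<rho> * mat_adjoint (local_op ds k (Ks ! i)))) = tr \<rho>"
proof -
  have "(\<Sum>i<length Ks. tr (local_op ds k (Ks ! i) * \<rho> * mat_adjoint (local_op ds k (Ks ! i)))) =
      (\<Sum>i<length Ks. tr (local_op ds k (mat_adjoint (Ks ! i) * Ks ! i) * \<rho>))"
  proof (rule sum.cong)
    fix i assume "i \<in> {..<length Ks}"
    then have i: "i < length Ks" by simp
    let ?L = "local_op ds k (Ks ! i)"
    have L: "?L \<in> carrier_mat (prod_list (ds[k := dim_row (Ks ! i)])) (prod_list ds)"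
      using assms i by (intro local_op_carrier) (auto simp: kraus_familyD)
    then have L': "mat_adjoint ?L \<in> carrier_mat (prod_list ds) (prod_list (ds[k := dim_row (Ks ! i)]))"
      by simp
    have "tr (?L * \<rho> * mat_adjoint ?L) = tr (mat_adjoint ?L * (?L * \<rho>))"
      using L L' assms(3) by (intro tr_comm) auto
    also have "\<dots> = tr (mat_adjoint ?L * ?L * \<rho>)"
      using assoc_mult_mat[OF L' L assms(3)] by simp
    finally show "tr (?L * \<rho> * mat_adjoint ?L) = tr (local_op ds k (mat_adjoint (Ks ! i) * Ks ! i) * \<rho>)"
      by (simp add: local_op_adjoint_mult)
  qed simp
  also have "\<dots> = tr (local_op ds k (1\<^sub>m (ds ! k)) * \<rho>)"
    using assms tr_local_op_foldr[of Ks "\<lambda>K. mat_adjoint K * K" ds k \<rho>]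
    unfolding kraus_family_def by fastforce
  also have "\<dots> = tr \<rho>"
    using assms by (simp add: local_op_one)
  finally show ?thesis .
qed

text \<open>Each measurement preserves the total trace, and a leaf assigns it to one output.
  Arbitrary matrices are allowed as input so that the statement can be applied to matrix
  units.\<close>

lemma sum_outcome_prob:
  fixes P :: "'o protocol"
  assumes "finite (UNIV :: 'o set)"
  shows "valid_protocol P ds \<Longrightarrow> \<rho> \<in> carrier_mat (prod_list ds) (prod_list ds) \<Longrightarrow>
    (\<Sum>x\<in>UNIV. outcome_prob P ds \<rho> x) = tr \<rho>"
proof (induction P arbitrary: ds \<rho>)
  case (Output y)
  then show ?case using assms by simp
next
  case (Measure k Ks nxt)
  have "(\<Sum>x\<in>UNIV. outcome_prob (Measure k Ks nxt) ds \<rho> x) =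
      (\<Sum>i<length Ks. \<Sum>x\<in>UNIV. outcome_prob (nxt i) (ds[k := dim_row (Ks ! i)])
        (local_op ds k (Ks ! i) * \<rho> * mat_adjoint (local_op ds k (Ks ! i))) x)"
    unfolding outcome_prob.simps by (rule sum.swap)
  also have "\<dots> = (\<Sum>i<length Ks. tr (local_op ds k (Ks ! i) * \<rho> * mat_adjoint (local_op ds k (Ks ! i))))"
  proof (rule sum.cong)
    fix i assume "i \<in> {..<length Ks}"
    then have i: "i < length Ks" by simp
    have L: "local_op ds k (Ks ! i) \<in> carrier_mat (prod_list (ds[k := dim_row (Ks ! i)])) (prod_list ds)"
      using Measure.prems i by (intro local_op_carrier) (auto simp: kraus_familyD)
    show "(\<Sum>x\<in>UNIV. outcome_prob (nxt i) (ds[k := dim_row (Ks ! i)])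
        (local_op ds k (Ks ! i) * \<rho> * mat_adjoint (local_op ds k (Ks ! i))) x) =
        tr (local_op ds k (Ks ! i) * \<rho> * mat_adjoint (local_op ds k (Ks ! i)))"
      using Measure.prems i L by (intro Measure.IH) auto
  qed simp
  also have "\<dots> = tr \<rho>" using Measure.prems by (intro sum_tr_kraus) auto
  finally show ?case .
qed

text \<open>Heisenberg picture: the effect of a leaf is the identity or zero, and a measurement
  pulls the effects \<open>E\<close> of its continuations back to
  \<open>mat_adjoint L * E * L\<close> and adds them up.\<close>

lemma ex_effect:
  "valid_protocol P ds \<Longrightarrow> \<exists>E \<in> carrier_mat (prod_list ds) (prod_list ds).
    \<forall>\<rho> \<in> carrier_mat (prod_list ds) (prod_list ds). outcome_prob P ds \<rho> x = tr (E * \<rho>)"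
proof (induction P arbitrary: ds)
  case (Output y)
  show ?case
  proof (cases "x = y")
    case True
    then show ?thesis by (intro bexI[of _ "1\<^sub>m (prod_list ds)"]) auto
  next
    case False
    then show ?thesis by (intro bexI[of _ "0\<^sub>m (prod_list ds) (prod_list ds)"]) (auto simp: tr_def)
  qed
next
  case (Measure k Ks nxt)
  let ?D = "prod_list ds" and ?D' = "\<lambda>i. prod_list (ds[k := dim_row (Ks ! i)])"
  let ?L = "\<lambda>i. local_op ds k (Ks ! i)"
  have L: "?L i \<in> carrier_mat (?D' i) ?D" if "i < length Ks" for i
    using Measure.prems that by (intro local_op_carrier) (auto simp: kraus_familyD)
  have "\<exists>E \<in> carrier_mat (?D' i) (?D' i). \<forall>\<rho> \<in> carrier_mat (?D' i) (?D' i).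
      outcome_prob (nxt i) (ds[k := dim_row (Ks ! i)]) \<rho> x = tr (E * \<rho>)" if "i < length Ks" for i
    using Measure.prems that by (intro Measure.IH) auto
  then obtain E where E: "\<And>i. i < length Ks \<Longrightarrow> E i \<in> carrier_mat (?D' i) (?D' i)"
    and prob: "\<And>i \<rho>. i < length Ks \<Longrightarrow> \<rho> \<in> carrier_mat (?D' i) (?D' i) \<Longrightarrow>
      outcome_prob (nxt i) (ds[k := dim_row (Ks ! i)]) \<rho> x = tr (E i * \<rho>)"
    by metis
  let ?G = "\<lambda>i. mat_adjoint (?L i) * E i * ?L i"
  have G: "?G i \<in> carrier_mat ?D ?D" if "i < length Ks" for i
    using E[OF that] L[OF that] by simp
  define F where "F = mat ?D ?D (\<lambda>(a, b). \<Sum>i<length Ks. ?G i $$ (a, b))"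
  have F: "F \<in> carrier_mat ?D ?D" by (simp add: F_def)
  show ?case
  proof (rule bexI[OF _ F], rule ballI)
    fix \<rho> :: "complex mat" assume \<rho>: "\<rho> \<in> carrier_mat ?D ?D"
    have "outcome_prob (Measure k Ks nxt) ds \<rho> x = (\<Sum>i<length Ks. tr (?G i * \<rho>))"
      unfolding outcome_prob.simps
    proof (rule sum.cong)
      fix i assume "i \<in> {..<length Ks}"
      then have i: "i < length Ks" by simp
      have L': "mat_adjoint (?L i) \<in> carrier_mat ?D (?D' i)" using L[OF i] by simp
      have "outcome_prob (nxt i) (ds[k := dim_row (Ks ! i)]) (?L i * \<rho> * mat_adjoint (?L i)) x =
          tr (E i * (?L i * \<rho> * mat_adjoint (?L i)))"
        using L[OF i] L' \<rho> i by (intro prob) auto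
      also have "\<dots> = tr (E i * ?L i * \<rho> * mat_adjoint (?L i))"
        using assoc_mult_mat[OF E[OF i] mult_carrier_mat[OF L[OF i] \<rho>] L']
          assoc_mult_mat[OF E[OF i] L[OF i] \<rho>] by simp
      also have "\<dots> = tr (mat_adjoint (?L i) * (E i * ?L i * \<rho>))"
        using L[OF i] L' \<rho> E[OF i] by (intro tr_comm) auto
      also have "mat_adjoint (?L i) * (E i * ?L i * \<rho>) = ?G i * \<rho>"
        using assoc_mult_mat[OF L' mult_carrier_mat[OF E[OF i] L[OF i]] \<rho>]
          assoc_mult_mat[OF L' E[OF i] L[OF i]] by simp
      finally show "outcome_prob (nxt i) (ds[k := dim_row (Ks ! i)])
          (?L i * \<rho> * mat_adjoint (?L i)) x = tr (?G i * \<rho>)" .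
    qed simp
    also have "\<dots> = (\<Sum>i<length Ks. \<Sum>a<?D. \<Sum>b<?D. ?G i $$ (a, b) * \<rho> $$ (b, a))"
      using G \<rho> by (intro sum.cong tr_mult) auto
    also have "\<dots> = (\<Sum>a<?D. \<Sum>b<?D. F $$ (a, b) * \<rho> $$ (b, a))"
      by (subst sum.swap, rule sum.cong[OF refl], subst sum.swap)
        (simp add: F_def sum_distrib_right del: index_mult_mat(1))
    also have "\<dots> = tr (F * \<rho>)" using F \<rho> by (rule tr_mult[symmetric])
    finally show "outcome_prob (Measure k Ks nxt) ds \<rho> x = tr (F * \<rho>)" .
  qed
qed

lemma UNIV_answer: "UNIV = {Yes, No, Inconclusive}"
  by (auto intro: answer.exhaust)

text \<open>Positivity of an effect is tested on the operators \<open>ket_bra v\<close>,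
  completeness on matrix units.\<close>

lemma ex_povm:
  assumes "valid_protocol P ds"
  shows "\<exists>M. answer_povm ds M \<and>
    (\<forall>\<rho> \<in> carrier_mat (prod_list ds) (prod_list ds). \<forall>x. outcome_prob P ds \<rho> x = tr (M x * \<rho>))"
proof -
  let ?D = "prod_list ds"
  obtain M where M: "\<And>x. M x \<in> carrier_mat ?D ?D"
    and prob: "\<And>x \<rho>. \<rho> \<in> carrier_mat ?D ?D \<Longrightarrow> outcome_prob P ds \<rho> x = tr (M x * \<rho>)"
    using ex_effect[OF assms] by metis
  have "positive_op ?D (M x)" for x
    unfolding positive_op_def
  proof (intro conjI ballI)
    fix v :: "complex vec" assume v: "v \<in> carrier_vec ?D"
    have "(M x *\<^sub>v v) \<bullet>c v = outcome_prob P ds (ket_bra v) x"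
      using prob[of "ket_bra v" x] tr_mult_ket_bra[OF M v] v by simp
    then show "0 \<le> (M x *\<^sub>v v) \<bullet>c v"
      using outcome_prob_nonneg[OF assms positive_op_ket_bra[OF v]] by simp
  qed (rule M)
  moreover have "M Yes + M No + M Inconclusive = 1\<^sub>m ?D"
  proof (rule eq_matI)
    fix i j assume "i < dim_row (1\<^sub>m ?D)" "j < dim_col (1\<^sub>m ?D)"
    then have ij: "i < ?D" "j < ?D" by auto
    \<comment> \<open>The matrix unit with its 1 at \<open>(j, i)\<close>, so that
      \<open>tr (A * U)\<close> is the entry \<open>A $$ (i, j)\<close>. Conservation of the trace
      on \<open>U\<close> is then the completeness relation in this entry.\<close>
    define U :: "complex mat" where "U = mat ?D ?D (\<lambda>(a, b). if a = j then if b = i then 1 else 0 else 0)"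
    have U: "U \<in> carrier_mat ?D ?D" by (simp add: U_def)
    have "(\<Sum>k<?D. A $$ (a, k) * U $$ (k, a)) = (if a = i then A $$ (a, j) else 0)"
      if "a < ?D" for A a
    proof -
      have "(\<Sum>k<?D. A $$ (a, k) * U $$ (k, a)) =
          (\<Sum>k<?D. if k = j then if a = i then A $$ (a, j) else 0 else 0)"
        using that by (intro sum.cong) (auto simp: U_def)
      then show ?thesis using ij by simp
    qed
    then have tr: "tr (A * U) = A $$ (i, j)" if "A \<in> carrier_mat ?D ?D" for A
      using ij by (simp add: tr_mult[OF that U])
    have "M Yes $$ (i, j) + M No $$ (i, j) + M Inconclusive $$ (i, j) = tr U"
      using sum_outcome_prob[OF _ assms U] prob[OF U] M by (simp add: UNIV_answer tr add.assoc)
    also have "tr U = 1\<^sub>m ?D $$ (i, j)"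
      using tr[of "1\<^sub>m ?D"] U by simp
    finally show "(M Yes + M No + M Inconclusive) $$ (i, j) = 1\<^sub>m ?D $$ (i, j)"
      using ij M[of Yes] M[of No] M[of Inconclusive] by (auto simp: add.assoc)
  qed (use M[of Inconclusive] in auto)
  ultimately show ?thesis using prob unfolding answer_povm_def by blast
qed

section \<open>Telling two vectors apart by local contractions\<close>

text \<open>
  Superpositions of at most two basis vectors suffice as \<open>\<phi>\<close>: if row \<open>i\<close> of \<open>B\<close> is \<open>c i\<close> times row \<open>i\<close>
  of \<open>A\<close>, they force \<open>c\<close> to be constant on the nonzero rows of \<open>A\<close>.
\<close>

lemma multiple_of_contractions:
  fixes A B :: "nat \<Rightarrow> nat \<Rightarrow> complex"
  assumes contr: "\<And>\<phi>. \<exists>c. \<forall>b<R. (\<Sum>i<d. \<phi> i * B i b) = c * (\<Sum>i<d. \<phi> i * A i b)"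
  shows "\<exists>c. \<forall>i<d. \<forall>b<R. B i b = c * A i b"
proof -
  \<comment> \<open>The superposition of basis vectors \<open>p\<close> and \<open>q\<close> with
    coefficients \<open>x\<close> and \<open>y\<close>, written as a sum of two indicators so that
    \<open>p = q\<close> is allowed.\<close>
  have two: "(\<Sum>i<d. ((if i = p then x else 0) + (if i = q then y else 0)) * C i b) = x * C p b + y * C q b"
    if "p < d" "q < d" for p q x y b and C :: "nat \<Rightarrow> nat \<Rightarrow> complex"
    using that by (simp add: distrib_right sum.distrib if_distrib[of "\<lambda>z. z * _"] cong: if_cong)
  have contr2: "\<exists>c. \<forall>b<R. x * B p b + y * B q b = c * (x * A p b + y * A q b)"
    if "p < d" "q < d" for p q x y
    using contr[of "\<lambda>i. (if i = p then x else 0) + (if i = q then y else 0)"]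
    by (simp only: two[OF that])
  have "\<exists>c. \<forall>b<R. B i b = c * A i b" if "i < d" for i
    using contr2[OF that that, of 1 0] by simp
  then obtain c where c: "\<And>i b. i < d \<Longrightarrow> b < R \<Longrightarrow> B i b = c i * A i b"
    by metis
  show ?thesis
  proof (cases "\<exists>i<d. \<exists>b<R. A i b \<noteq> 0")
    case False
    then show ?thesis using c by fastforce
  next
    case True
    then obtain p b0 where p: "p < d" "b0 < R" "A p b0 \<noteq> 0" by blast
    have "B i b = c p * A i b" if i: "i < d" and b: "b < R" for i b
    proof (cases "A i b = 0")
      case True
      then show ?thesis using c[OF i b] by simp
    next
      case nz: False
      have "c i = c p"
      proof (cases "A i b0 = 0")
        case False
        \<comment> \<open>These coefficients cancel the rows of \<open>A\<close> in column
          \<open>b0\<close>, whatever \<open>e\<close> is. So the rows of \<open>B\<close> cancel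
          there too, which is \<open>c i = c p\<close>.\<close>
        obtain e where "\<forall>b<R. A i b0 * B p b + - A p b0 * B i b =
            e * (A i b0 * A p b + - A p b0 * A i b)"
          using contr2[OF p(1) i, of "A i b0" "- A p b0"] by blast
        then have "A i b0 * B p b0 = A p b0 * B i b0" using p(2) by (auto simp: algebra_simps)
        then show ?thesis using p False c[OF p(1,2)] c[OF i p(2)] by simp
      next
        case True
        \<comment> \<open>Row \<open>i\<close> of \<open>A\<close> vanishes in column
          \<open>b0\<close>, so there the plain sum of the rows fixes \<open>e = c p\<close>. Column
          \<open>b\<close>, where row \<open>i\<close> is nonzero, then gives
          \<open>c i = c p\<close>.\<close>
        obtain e where e: "\<forall>b<R. 1 * B p b + 1 * B i b = e * (1 * A p b + 1 * A i b)"
          using contr2[OF p(1) i, of 1 1] by blast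
        then have "e = c p" using p True c[OF p(1,2)] c[OF i p(2)] by auto
        then have "c p * A p b + c i * A i b = c p * (A p b + A i b)"
          using e b c[OF p(1) b] c[OF i b] by (metis mult_1)
        then show ?thesis using nz by (simp add: distrib_left)
      qed
      then show ?thesis using c[OF i b] by simp
    qed
    then show ?thesis by blast
  qed
qed

text \<open>The contrapositive of \<open>multiple_of_contractions\<close>, with the vector found
  there rescaled to norm 1, which changes both contractions by the same factor.\<close>

lemma ex_unit_contraction:
  fixes A B :: "nat \<Rightarrow> nat \<Rightarrow> complex"
  assumes "\<And>c. \<exists>i<d. \<exists>b<R. B i b \<noteq> c * A i b"
  shows "\<exists>\<phi>. (\<Sum>i<d. \<phi> i * cnj (\<phi> i)) = 1 \<and>
    (\<forall>c. \<exists>b<R. (\<Sum>i<d. \<phi> i * B i b) \<noteq> c * (\<Sum>i<d. \<phi> i * A i b))"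
proof -
  obtain \<phi> where \<phi>: "\<And>c. \<exists>b<R. (\<Sum>i<d. \<phi> i * B i b) \<noteq> c * (\<Sum>i<d. \<phi> i * A i b)"
    using multiple_of_contractions[where A = A and B = B and R = R and d = d] assms by meson
  \<comment> \<open>For \<open>\<phi> = 0\<close> both contractions vanish and would be related by
    \<open>c = 0\<close>; so \<open>\<phi>\<close> can be normalized.\<close>
  have "\<exists>i<d. \<phi> i \<noteq> 0"
  proof (rule ccontr)
    assume "\<not> (\<exists>i<d. \<phi> i \<noteq> 0)"
    then have "(\<Sum>i<d. \<phi> i * C i b) = 0" for C :: "nat \<Rightarrow> nat \<Rightarrow> complex" and b
      by (intro sum.neutral) auto
    then show False using \<phi>[of 0] by simp
  qed
  then obtain i0 where i0: "i0 < d" "\<phi> i0 \<noteq> 0" by blast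
  define N where "N = (\<Sum>i<d. (cmod (\<phi> i))\<^sup>2)"
  have "0 < N" unfolding N_def using i0 by (intro sum_pos2[of _ i0]) auto
  define s where "s = complex_of_real (sqrt N)"
  have s: "s \<noteq> 0" "s * cnj s = of_real N"
    using \<open>0 < N\<close> by (auto simp: s_def simp flip: of_real_mult)
  have "(\<Sum>i<d. \<phi> i / s * cnj (\<phi> i / s)) = (\<Sum>i<d. \<phi> i * cnj (\<phi> i)) / of_real N"
    by (simp add: sum_divide_distrib s(2))
  also have "(\<Sum>i<d. \<phi> i * cnj (\<phi> i)) = of_real N"
    by (simp only: N_def of_real_sum complex_norm_square)
  finally have "(\<Sum>i<d. \<phi> i / s * cnj (\<phi> i / s)) = 1" using \<open>0 < N\<close> by simp
  moreover have "\<exists>b<R. (\<Sum>i<d. \<phi> i / s * B i b) \<noteq> c * (\<Sum>i<d. \<phi> i / s * A i b)" for c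
    using \<phi>[of c] s(1) by (simp flip: sum_divide_distrib)
  ultimately show ?thesis by (intro exI[of _ "\<lambda>i. \<phi> i / s"]) blast
qed

text \<open>As \<open>K\<close> is a unit row vector, \<open>mat_adjoint K * K\<close> is an
  orthogonal projection. Its complement is self-adjoint and idempotent, so it can itself be the
  Kraus operator that completes the measurement.\<close>

lemma kraus_family_bra:
  fixes K :: "complex mat"
  assumes K: "K \<in> carrier_mat 1 d" and unit: "K * mat_adjoint K = 1\<^sub>m 1" and "d > 0"
  shows "kraus_family d [K, 1\<^sub>m d - mat_adjoint K * K]"
proof -
  have K': "mat_adjoint K \<in> carrier_mat d 1" using K by simp
  define P where "P = mat_adjoint K * K"
  have P: "P \<in> carrier_mat d d" using K by (simp add: P_def)
  have "K * P = K"
    using assoc_mult_mat[OF K K' K] left_mult_one_mat[OF K] by (simp add: P_def unit)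
  then have PP: "P * P = P"
    using assoc_mult_mat[OF K' K P] by (simp add: P_def)
  have "mat_adjoint P = P"
    unfolding P_def by (subst mat_adjoint_mult[OF K' K]) (rule arg_cong2[where f = "(*)"]; rule eq_matI; simp)
  then have cnj_P: "cnj (P $$ (j, i)) = P $$ (i, j)" if "i < d" "j < d" for i j
    using that P mat_adjoint_index[of i P j] by simp
  have adj: "mat_adjoint (1\<^sub>m d - P) = 1\<^sub>m d - P"
    using P by (intro eq_matI) (auto simp: cnj_P)
  have Q: "1\<^sub>m d - P \<in> carrier_mat d d" by (rule minus_carrier_mat[OF P])
  have "(1\<^sub>m d - P) * P = 0\<^sub>m d d"
    using P by (simp add: minus_mult_distrib_mat[OF one_carrier_mat P P] PP)
  then have "(1\<^sub>m d - P) * (1\<^sub>m d - P) = 1\<^sub>m d - P - 0\<^sub>m d d"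
    using mult_minus_distrib_mat[OF Q one_carrier_mat P] right_mult_one_mat[OF Q] by simp
  then have "P + (mat_adjoint (1\<^sub>m d - P) * (1\<^sub>m d - P) + 0\<^sub>m d d) = 1\<^sub>m d"
    unfolding adj using P by (intro eq_matI) auto
  then show ?thesis
    using K \<open>d > 0\<close> by (auto simp: kraus_family_def P_def)
qed

text \<open>Contraction of the first tensor factor with the row \<open>K\<close>: coordinate
  \<open>i * r + b\<close> belongs to basis vector \<open>i\<close> of that factor and
  \<open>b\<close> of the rest.\<close>

lemma kron_row_mult_vec_index:
  assumes "K \<in> carrier_mat 1 d" "v \<in> carrier_vec (d * r)" "b < r"
  shows "(kron K (1\<^sub>m r) *\<^sub>v v) $ b = (\<Sum>i<d. K $$ (0, i) * v $ (i * r + b))"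
proof -
  have "(kron K (1\<^sub>m r) *\<^sub>v v) $ b = (\<Sum>k<d * r. kron K (1\<^sub>m r) $$ (b, k) * v $ k)"
    using assms kron_carrier[OF assms(1) one_carrier_mat[of r]]
    by (intro mult_mat_vec_index) simp_all
  also have "\<dots> = (\<Sum>k<d * r. K $$ (0, k div r) * (if b = k mod r then 1 else 0) *
      v $ (k div r * r + k mod r))"
    using assms by (intro sum.cong) (auto simp: kron_index)
  also have "\<dots> = (\<Sum>i<d. \<Sum>j<r. K $$ (0, i) * (if b = j then 1 else 0) * v $ (i * r + j))"
    by (rule sum_divmod)
  also have "\<dots> = (\<Sum>i<d. K $$ (0, i) * v $ (i * r + b))"
    using assms(3) by (intro sum.cong refl)
      (simp add: if_distrib[of "\<lambda>z. _ * z * _"] cong: if_cong)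
  finally show ?thesis .
qed

text \<open>Induction on the factors not yet contracted. The \<open>m\<close> contracted ones stay
  in the list with dimension 1, since a measurement never removes a party. A failed projection ends
  with \<open>Inconclusive\<close> and full success with \<open>No\<close>, so \<open>Yes\<close>
  never occurs.\<close>

lemma ex_discriminating_protocol:
  assumes "\<forall>d \<in> set es. d > 0" "\<psi> \<in> carrier_vec (prod_list es)" "\<chi> \<in> carrier_vec (prod_list es)"
    "\<And>c. \<chi> \<noteq> c \<cdot>\<^sub>v \<psi>"
  shows "\<exists>P. valid_protocol P (replicate m 1 @ es) \<and>
    outcome_prob P (replicate m 1 @ es) (ket_bra \<psi>) No = 0 \<and>
    outcome_prob P (replicate m 1 @ es) (ket_bra \<chi>) No \<noteq> 0 \<and>
    (\<forall>\<rho>. outcome_prob P (replicate m 1 @ es) \<rho> Yes = 0)"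
  using assms
proof (induction es arbitrary: m \<psi> \<chi>)
  case Nil
  \<comment> \<open>The empty product of dimensions is 1, so both vectors are scalars; not being a
    multiple of \<open>\<psi>\<close> then means that \<open>\<psi>\<close> is zero and
    \<open>\<chi>\<close> is not.\<close>
  then have dim: "dim_vec \<psi> = 1" "dim_vec \<chi> = 1" by auto
  have "\<psi> $ 0 = 0"
  proof (rule ccontr)
    assume "\<psi> $ 0 \<noteq> 0"
    then have "\<chi> = (\<chi> $ 0 / \<psi> $ 0) \<cdot>\<^sub>v \<psi>" using dim by (intro eq_vecI) auto
    then show False using Nil by blast
  qed
  moreover have "\<chi> $ 0 \<noteq> 0"
  proof
    assume "\<chi> $ 0 = 0"
    then have "\<chi> = 0 \<cdot>\<^sub>v \<psi>" using dim by (intro eq_vecI) auto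
    then show False using Nil by blast
  qed
  ultimately show ?case
    using dim by (intro exI[of _ "Output No"]) (simp add: tr_def ket_bra_def)
next
  case (Cons d es)
  let ?ds = "replicate m 1 @ d # es" and ?ds' = "replicate (Suc m) 1 @ es" and ?R = "prod_list es"
  have d: "d > 0" using Cons.prems(1) by simp
  have vec: "\<psi> \<in> carrier_vec (d * ?R)" "\<chi> \<in> carrier_vec (d * ?R)"
    using Cons.prems(2,3) by auto
  \<comment> \<open>Both vectors are read as \<open>d\<close> by \<open>?R\<close> arrays, whose
    rows belong to the basis vectors of the factor to be contracted next.\<close>
  have "\<exists>i<d. \<exists>b<?R. \<chi> $ (i * ?R + b) \<noteq> c * \<psi> $ (i * ?R + b)" for c
  proof (rule ccontr)
    assume "\<not> ?thesis"
    then have eq: "\<chi> $ (i * ?R + b) = c * \<psi> $ (i * ?R + b)" if "i < d" "b < ?R" for i b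
      using that by blast
    have "\<chi> = c \<cdot>\<^sub>v \<psi>"
    proof (rule eq_vecI)
      fix k assume "k < dim_vec (c \<cdot>\<^sub>v \<psi>)"
      then have "k < d * ?R" using vec by simp
      from less_mult_divmod[OF this] eq[of "k div ?R" "k mod ?R"]
      show "\<chi> $ k = (c \<cdot>\<^sub>v \<psi>) $ k" using vec \<open>k < d * ?R\<close> by simp
    qed (use vec in simp)
    then show False using Cons.prems(4) by blast
  qed
  from ex_unit_contraction[of d ?R "\<lambda>i b. \<chi> $ (i * ?R + b)" "\<lambda>i b. \<psi> $ (i * ?R + b)", OF this]
  obtain \<phi> where unit: "(\<Sum>i<d. \<phi> i * cnj (\<phi> i)) = 1"
    and ne: "\<And>c. \<exists>b<?R. (\<Sum>i<d. \<phi> i * \<chi> $ (i * ?R + b)) \<noteq> c * (\<Sum>i<d. \<phi> i * \<psi> $ (i * ?R + b))"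
    by blast
  define K where "K = mat 1 d (\<lambda>(a, i). \<phi> i)"
  have K: "K \<in> carrier_mat 1 d" by (simp add: K_def)
  have KK: "K * mat_adjoint K = 1\<^sub>m 1"
  proof (rule eq_matI)
    fix i j assume "i < dim_row (1\<^sub>m 1 :: complex mat)" "j < dim_col (1\<^sub>m 1 :: complex mat)"
    then show "(K * mat_adjoint K) $$ (i, j) = 1\<^sub>m 1 $$ (i, j)"
      using mult_mat_index[OF K, of "mat_adjoint K" 1 i j] K unit by (simp add: K_def)
  qed (use K in auto)
  let ?Ks = "[K, 1\<^sub>m d - mat_adjoint K * K]"
  let ?L = "kron K (1\<^sub>m ?R)"
  have L: "?L \<in> carrier_mat ?R (d * ?R)"
    using kron_carrier[OF K one_carrier_mat[of ?R]] by simp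
  have entry: "(?L *\<^sub>v v) $ b = (\<Sum>i<d. \<phi> i * v $ (i * ?R + b))"
    if "v \<in> carrier_vec (d * ?R)" "b < ?R" for v b
    unfolding kron_row_mult_vec_index[OF K that] by (simp add: K_def)
  have "?L *\<^sub>v \<chi> \<noteq> c \<cdot>\<^sub>v (?L *\<^sub>v \<psi>)" for c
  proof
    assume eq: "?L *\<^sub>v \<chi> = c \<cdot>\<^sub>v (?L *\<^sub>v \<psi>)"
    obtain b where b: "b < ?R"
      "(\<Sum>i<d. \<phi> i * \<chi> $ (i * ?R + b)) \<noteq> c * (\<Sum>i<d. \<phi> i * \<psi> $ (i * ?R + b))"
      using ne by blast
    have "(?L *\<^sub>v \<chi>) $ b = c * (?L *\<^sub>v \<psi>) $ b"
      unfolding eq using b(1) K by (intro index_smult_vec) auto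
    then show False using b entry vec by metis
  qed
  moreover have "?L *\<^sub>v \<psi> \<in> carrier_vec ?R" "?L *\<^sub>v \<chi> \<in> carrier_vec ?R"
    using L vec by (auto intro: mult_mat_vec_carrier)
  ultimately obtain P where P: "valid_protocol P ?ds'"
    "outcome_prob P ?ds' (ket_bra (?L *\<^sub>v \<psi>)) No = 0"
    "outcome_prob P ?ds' (ket_bra (?L *\<^sub>v \<chi>)) No \<noteq> 0"
    "\<And>\<rho>. outcome_prob P ?ds' \<rho> Yes = 0"
    using Cons.IH[of "?L *\<^sub>v \<psi>" "?L *\<^sub>v \<chi>" "Suc m"] Cons.prems(1) by auto
  \<comment> \<open>Result 0 is the successful contraction, result 1 gives up.\<close>
  define Q where "Q = Measure m ?Ks (\<lambda>i. if i = 0 then P else Output Inconclusive)"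
  \<comment> \<open>The measured factor shrinks to dimension 1 and joins the contracted ones. All
    factors before it have dimension 1, so the identity on them is the 1 by 1 matrix and drops out
    of \<open>local_op\<close>.\<close>
  have upd: "?ds[m := dim_row (?Ks ! 0)] = ?ds'"
    using K by (simp add: list_update_append replicate_append_same[symmetric])
  have loc: "local_op ?ds m (?Ks ! 0) = ?L"
    by (simp add: local_op_def kron_one_left[unfolded One_nat_def])
  have "valid_protocol Q ?ds"
    using kraus_family_bra[OF K KK d] P(1) upd
    by (auto simp: Q_def nth_append less_Suc_eq)
  moreover have "outcome_prob Q ?ds \<rho> x = outcome_prob P ?ds' (?L * \<rho> * mat_adjoint ?L) x"
    if "x \<noteq> Inconclusive" for \<rho> x
  proof -
    have "{..<length ?Ks} = {0, 1}" by auto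
    then show ?thesis using that unfolding Q_def outcome_prob.simps
      by (simp only: sum.insert upd loc) (use upd loc in simp)
  qed
  ultimately show ?case
    using P conj_ket_bra[OF L vec(1)] conj_ket_bra[OF L vec(2)] by (intro exI[of _ Q]) simp
qed

section \<open>Pure states admit conclusive LRA\<close>

text \<open>It suffices to exhibit a protocol, whose POVM is supplied by \<open>ex_povm\<close>. As
  outcome probabilities are nonnegative, a single state \<open>\<tau>\<close> with a possible
  conclusive outcome makes the average positive.\<close>

lemma conclusively_answerableI:
  assumes P: "valid_protocol P ds" and "finite S"
    and pos: "\<And>\<sigma>. \<sigma> \<in> S \<Longrightarrow> positive_op (prod_list ds) \<sigma>"
    and yes: "\<And>\<sigma>. \<sigma> \<in> S - {\<rho>} \<Longrightarrow> outcome_prob P ds \<sigma> Yes = 0"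
    and "\<rho> \<in> S" and no: "outcome_prob P ds \<rho> No = 0"
    and "\<tau> \<in> S" "outcome_prob P ds \<tau> Yes + outcome_prob P ds \<tau> No \<noteq> 0"
  shows "conclusively_answerable ds S \<rho>"
proof -
  let ?D = "prod_list ds"
  obtain M where M: "answer_povm ds M"
    and prob: "\<And>\<sigma> x. \<sigma> \<in> carrier_mat ?D ?D \<Longrightarrow> outcome_prob P ds \<sigma> x = tr (M x * \<sigma>)"
    using ex_povm[OF P] by blast
  have car: "\<sigma> \<in> carrier_mat ?D ?D" if "\<sigma> \<in> S" for \<sigma>
    using pos[OF that] by (simp add: positive_op_def)
  have Mc: "M x \<in> carrier_mat ?D ?D" for x
    using M by (simp add: answer_povm_def positive_op_def)
  have "locc_implementable ds M"
    unfolding locc_implementable_def using P prob by (auto simp: density_op_def positive_op_def)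
  moreover have "\<forall>\<sigma> \<in> S - {\<rho>}. tr (M Yes * \<sigma>) = 0" "tr (M No * \<rho>) = 0"
    using yes no car prob \<open>\<rho> \<in> S\<close> by (auto simp: car)
  moreover have "1 / of_nat (card S) * (\<Sum>\<sigma> \<in> S. tr ((M Yes + M No) * \<sigma>)) > 0"
  proof -
    let ?p = "\<lambda>\<sigma>. outcome_prob P ds \<sigma> Yes + outcome_prob P ds \<sigma> No"
    have nonneg: "0 \<le> ?p \<sigma>" if "\<sigma> \<in> S" for \<sigma>
      using outcome_prob_nonneg[OF P pos[OF that]] by (intro add_nonneg_nonneg)
    have "(\<Sum>\<sigma> \<in> S. tr ((M Yes + M No) * \<sigma>)) = (\<Sum>\<sigma> \<in> S. ?p \<sigma>)"
    proof (rule sum.cong)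
      fix \<sigma> assume "\<sigma> \<in> S"
      then have "\<sigma> \<in> carrier_mat ?D ?D" by (rule car)
      then show "tr ((M Yes + M No) * \<sigma>) = ?p \<sigma>"
        by (simp add: prob tr_add_mult[OF Mc Mc])
    qed simp
    also have "(\<Sum>\<sigma> \<in> S. ?p \<sigma>) > 0"
      using \<open>finite S\<close> \<open>\<tau> \<in> S\<close> nonneg assms(8)
      by (intro sum_pos2[of _ \<tau>]) (auto simp: order.strict_iff_order)
    finally have "(\<Sum>\<sigma> \<in> S. tr ((M Yes + M No) * \<sigma>)) > 0" .
    moreover have "card S > 0" using \<open>finite S\<close> \<open>\<rho> \<in> S\<close> by (auto simp: card_gt_0_iff)
    ultimately show ?thesis
      by (simp add: less_complex_def)
  qed
  ultimately show ?thesis unfolding conclusively_answerable_def using M by blast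
qed

text \<open>Only one other state \<open>\<sigma>\<close> has to be detected with nonzero
  probability. The protocol for it never says \<open>Yes\<close>, so the remaining states cannot
  cause a wrong answer. If there is no other state, \<open>Yes\<close> is always right.\<close>

lemma conclusive_LRA_pure_states:
  assumes "multipartite ds" "finite S" and pure: "\<And>\<rho>. \<rho> \<in> S \<Longrightarrow> pure_state ds \<rho>"
    and orth: "mutually_orthogonal S"
  shows "conclusive_LRA ds S"
  unfolding conclusive_LRA_def
proof
  fix \<rho> assume \<rho>: "\<rho> \<in> S"
  let ?D = "prod_list ds"
  have pos: "positive_op ?D \<sigma>" if "\<sigma> \<in> S" for \<sigma>
    using pure[OF that] by (auto simp: pure_state_def positive_op_ket_bra)
  obtain \<psi> where \<psi>: "\<psi> \<in> carrier_vec ?D" "\<psi> \<bullet>c \<psi> = 1" "\<rho> = ket_bra \<psi>"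
    using pure[OF \<rho>] by (auto simp: pure_state_def)
  show "conclusively_answerable ds S \<rho>"
  proof (cases "S = {\<rho>}")
    case True
    show ?thesis
      by (rule conclusively_answerableI[where P = "Output Yes" and \<tau> = \<rho>])
        (use pos \<rho> True \<psi> in \<open>auto simp: tr_ket_bra\<close>)
  next
    case False
    then obtain \<sigma> where \<sigma>: "\<sigma> \<in> S" "\<sigma> \<noteq> \<rho>" using \<rho> by blast
    obtain \<chi> where \<chi>: "\<chi> \<in> carrier_vec ?D" "\<chi> \<bullet>c \<chi> = 1" "\<sigma> = ket_bra \<chi>"
      using pure[OF \<sigma>(1)] by (auto simp: pure_state_def)
    have "tr (\<rho> * \<sigma>) = 0" using orth \<rho> \<sigma> by (auto simp: mutually_orthogonal_def)
    then have orth0: "\<chi> \<bullet>c \<psi> = 0"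
      using \<psi>(1,3) \<chi>(1,3) by (simp add: tr_ket_bra_mult_ket_bra[of _ ?D])
    have "\<chi> \<noteq> c \<cdot>\<^sub>v \<psi>" for c
    proof
      assume eq: "\<chi> = c \<cdot>\<^sub>v \<psi>"
      have "\<chi> \<bullet>c \<psi> = c * (\<psi> \<bullet>c \<psi>)"
        unfolding eq using \<psi>(1) by simp
      then have "c = 0" using orth0 \<psi>(2) by simp
      then show False using eq \<chi>(1,2) \<psi>(1) by (simp add: cscalar_prod_eq[of _ ?D])
    qed
    then obtain P where "valid_protocol P ds" "outcome_prob P ds \<rho> No = 0"
      "outcome_prob P ds \<sigma> No \<noteq> 0" "\<And>\<tau>. outcome_prob P ds \<tau> Yes = 0"
      using ex_discriminating_protocol[of ds \<psi> \<chi> 0] assms(1) \<psi> \<chi>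
      by (auto simp: multipartite_def)
    then show ?thesis
      using \<open>finite S\<close> pos \<rho> \<sigma>(1) by (intro conclusively_answerableI[where \<tau> = \<sigma>]) auto
  qed
qed

section \<open>The two GHZ mixtures\<close>

text \<open>
  \<open>ghz_mixture s\<close> is the uniform mixture of the four GHZ states
  \<open>(e\<^sub>k + s \<epsilon>\<^sub>k e\<^sub>7\<^sub>-\<^sub>k) / \<surd>2\<close>, \<open>k < 4\<close>. With \<open>\<epsilon> = 1\<close> product vectors orthogonal to all of them
  exist; there are none because the four signs have product \<open>-1\<close>.
\<close>

definition ghz_sign :: "nat \<Rightarrow> complex" where
  "ghz_sign i = (if i = 3 \<or> i = 4 then - 1 else 1)"

definition ghz_mixture :: "complex \<Rightarrow> complex mat" where
  "ghz_mixture s = mat 8 8 (\<lambda>(i, j).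
     if i = j then 1 / 8 else if i + j = 7 then s * ghz_sign i / 8 else 0)"

lemma ghz_mixture_carrier [simp]: "ghz_mixture s \<in> carrier_mat 8 8"
  by (simp add: ghz_mixture_def)

lemma sum_less_8: "(\<Sum>k<8. f k) = f 0 + f 1 + f 2 + f 3 + f 4 + f 5 + f 6 + f 7"
  for f :: "nat \<Rightarrow> 'a :: comm_monoid_add"
  by (simp add: eval_nat_numeral lessThan_Suc add_ac)

lemma sum_less_4: "(\<Sum>k<4. f k) = f 0 + f 1 + f 2 + f 3"
  for f :: "nat \<Rightarrow> 'a :: comm_monoid_add"
  by (simp add: eval_nat_numeral lessThan_Suc add_ac)

text \<open>The antidiagonal couples \<open>k\<close> only with \<open>7 - k\<close>, and since
  \<open>s\<close> and the signs square to 1 each such pair completes a square. This yields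
  positivity and describes the kernel by four linear equations.\<close>

lemma ghz_mixture_form:
  assumes "s = 1 \<or> s = - 1"
  shows "(\<Sum>k<8. \<Sum>l<8. p k * ghz_mixture s $$ (k, l) * cnj (p l)) =
    (\<Sum>k<4. (p k + s * ghz_sign k * p (7 - k)) * cnj (p k + s * ghz_sign k * p (7 - k))) / 8"
proof -
  have "(\<Sum>l<8. p k * ghz_mixture s $$ (k, l) * cnj (p l)) =
      (p k * cnj (p k) + s * ghz_sign k * p k * cnj (p (7 - k))) / 8" if "k < 8" for k
  proof -
    \<comment> \<open>The diagonal and the antidiagonal do not meet, so an entry is a sum of two
      indicator terms.\<close>
    have "k + k \<noteq> 7" by presburger
    have "(\<Sum>l<8. p k * ghz_mixture s $$ (k, l) * cnj (p l)) =
        (\<Sum>l<8. (if l = k then p k * cnj (p k) / 8 else 0) +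
          (if l = 7 - k then s * ghz_sign k * p k * cnj (p (7 - k)) / 8 else 0))"
      using that \<open>k + k \<noteq> 7\<close> by (intro sum.cong) (auto simp: ghz_mixture_def)
    then show ?thesis using that by (simp add: sum.distrib add_divide_distrib)
  qed
  then show ?thesis
    using assms by (auto simp: sum_less_8 sum_less_4 ghz_sign_def algebra_simps add_divide_distrib diff_divide_distrib)
qed

lemma mult_cnj_nonneg: "0 \<le> z * cnj z"
  by (metis conjugate_square_positive conjugate_complex_def)

lemma ghz_form_nonneg:
  "0 \<le> (\<Sum>k<4. (p k + s * ghz_sign k * p (7 - k)) * cnj (p k + s * ghz_sign k * p (7 - k))) / 8"
  for p :: "nat \<Rightarrow> complex"
proof -
  have "0 \<le> (\<Sum>k<4. (p k + s * ghz_sign k * p (7 - k)) * cnj (p k + s * ghz_sign k * p (7 - k)))"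
    by (intro sum_nonneg mult_cnj_nonneg)
  then show ?thesis by (simp add: less_eq_complex_def)
qed

lemma mixed_state_ghz_mixture:
  assumes "s = 1 \<or> s = - 1"
  shows "mixed_state [2, 2, 2] (ghz_mixture s)"
proof -
  have "positive_op 8 (ghz_mixture s)"
    unfolding positive_op_def
  proof (intro conjI ballI)
    fix v :: "complex vec" assume v: "v \<in> carrier_vec 8"
    \<comment> \<open>The inner product conjugates its second argument, so the coefficients
      \<open>p k\<close> are the conjugates \<open>cnj (v $ k)\<close>.\<close>
    have "(ghz_mixture s *\<^sub>v v) \<bullet>c v =
        (\<Sum>k<8. \<Sum>l<8. cnj (v $ k) * ghz_mixture s $$ (k, l) * cnj (cnj (v $ l)))"
      using v mult_mat_vec_carrier[OF ghz_mixture_carrier v]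
      by (simp add: cscalar_prod_eq[of _ 8] mult_mat_vec_index[OF ghz_mixture_carrier]
          sum_distrib_left sum_distrib_right mult_ac del: index_mult_mat_vec)
    also have "\<dots> \<ge> 0" unfolding ghz_mixture_form[OF assms] by (rule ghz_form_nonneg)
    finally show "0 \<le> (ghz_mixture s *\<^sub>v v) \<bullet>c v" .
  qed simp
  moreover have "tr (ghz_mixture s) = 1"
    by (simp add: tr_def ghz_mixture_def)
  moreover have "\<not> pure_state [2, 2, 2] (ghz_mixture s)"
  proof
    assume "pure_state [2, 2, 2] (ghz_mixture s)"
    then obtain \<psi> where "\<psi> \<in> carrier_vec 8" "ghz_mixture s = ket_bra \<psi>"
      by (auto simp: pure_state_def)
    then have entry: "\<psi> $ i * cnj (\<psi> $ j) = ghz_mixture s $$ (i, j)" if "i < 8" "j < 8" for i j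
      using that by (simp add: ket_bra_def)
    \<comment> \<open>The diagonal entries are nonzero, whereas \<open>(0, 1)\<close> lies on
      neither diagonal; a rank-one operator cannot have both properties.\<close>
    have "\<psi> $ 0 \<noteq> 0" "\<psi> $ 1 \<noteq> 0" "\<psi> $ 0 * cnj (\<psi> $ 1) = 0"
      using entry[of 0 0] entry[of 1 1] entry[of 0 1] by (auto simp: ghz_mixture_def)
    then show False by simp
  qed
  ultimately show ?thesis by (simp add: mixed_state_def density_op_def)
qed

text \<open>Gives orthogonality of the two mixtures, as the value is 0 when \<open>s\<close> is 1 or
  -1.\<close>

lemma tr_ghz_mixture_mult: "tr (ghz_mixture s * ghz_mixture (- s)) = (1 - s * s) / 8"
  by (simp add: tr_mult[OF ghz_mixture_carrier ghz_mixture_carrier] sum_less_8)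
    (simp add: ghz_mixture_def ghz_sign_def field_simps)

text \<open>
  Multiplying the first equation by the fourth and the second by the third gives
  \<open>x0\<^sup>2 q = - x1\<^sup>2 q\<close> and \<open>x0\<^sup>2 q = x1\<^sup>2 q\<close> with \<open>q = y0 y1 z0 z1\<close>.
\<close>

lemma product_in_ghz_kernel:
  fixes x0 x1 y0 y1 z0 z1 s :: complex
  assumes s: "s * s = 1"
    and eqs: "x0 * y0 * z0 + s * (x1 * y1 * z1) = 0" "x0 * y0 * z1 + s * (x1 * y1 * z0) = 0"
      "x0 * y1 * z0 + s * (x1 * y0 * z1) = 0" "x0 * y1 * z1 - s * (x1 * y0 * z0) = 0"
  shows "(x0 = 0 \<and> x1 = 0) \<or> (y0 = 0 \<and> y1 = 0) \<or> (z0 = 0 \<and> z1 = 0)"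
proof -
  let ?q = "y0 * y1 * z0 * z1"
  have r: "x0 * y0 * z0 = - (s * (x1 * y1 * z1))" "x0 * y0 * z1 = - (s * (x1 * y1 * z0))"
    "x0 * y1 * z0 = - (s * (x1 * y0 * z1))" "x0 * y1 * z1 = s * (x1 * y0 * z0)"
    using eqs by (simp_all add: eq_neg_iff_add_eq_0)
  have "x0 * x0 * ?q = (x0 * y0 * z0) * (x0 * y1 * z1)" by (simp add: mult_ac)
  also have "\<dots> = - (s * s) * (x1 * x1 * ?q)" unfolding r by (simp add: mult_ac)
  finally have "x0 * x0 * ?q = - (x1 * x1 * ?q)" by (simp add: s)
  moreover have "x0 * x0 * ?q = (x0 * y0 * z1) * (x0 * y1 * z0)" by (simp add: mult_ac)
  then have "x0 * x0 * ?q = (s * s) * (x1 * x1 * ?q)" unfolding r by (simp add: mult_ac)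
  ultimately have "x0 * x0 * ?q = 0" "x1 * x1 * ?q = 0" unfolding s by auto
  moreover have "s \<noteq> 0" using s by auto
  \<comment> \<open>Either \<open>x0 = x1 = 0\<close>, or one of \<open>y0\<close>,
    \<open>y1\<close>, \<open>z0\<close>, \<open>z1\<close> vanishes. In the latter case one term
    drops out of each equation, and the remaining monomials force one of the three vectors to be
    zero.\<close>
  ultimately show ?thesis using eqs by auto
qed

text \<open>Conjugation inserts every row of \<open>L\<close> into the form of
  \<open>ghz_mixture_form\<close>, so a vanishing trace becomes a condition on each row
  separately.\<close>

lemma tr_conj_ghz_mixture:
  assumes "s = 1 \<or> s = - 1" "L \<in> carrier_mat m 8"
  shows "tr (L * ghz_mixture s * mat_adjoint L) =
    (\<Sum>r<m. (\<Sum>k<4. (L $$ (r, k) + s * ghz_sign k * L $$ (r, 7 - k)) *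
      cnj (L $$ (r, k) + s * ghz_sign k * L $$ (r, 7 - k))) / 8)"
proof -
  have "tr (L * ghz_mixture s * mat_adjoint L) =
      (\<Sum>r<m. \<Sum>l<8. (L * ghz_mixture s) $$ (r, l) * mat_adjoint L $$ (l, r))"
    using assms(2) by (intro tr_mult) auto
  also have "\<dots> = (\<Sum>r<m. \<Sum>l<8. \<Sum>k<8. L $$ (r, k) * ghz_mixture s $$ (k, l) * cnj (L $$ (r, l)))"
    using assms(2) by (simp add: mult_mat_index[OF assms(2) ghz_mixture_carrier] sum_distrib_right
        del: index_mult_mat(1))
  also have "\<dots> = (\<Sum>r<m. \<Sum>k<8. \<Sum>l<8. L $$ (r, k) * ghz_mixture s $$ (k, l) * cnj (L $$ (r, l)))"
    by (intro sum.cong refl sum.swap)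
  finally show ?thesis unfolding ghz_mixture_form[OF assms(1)] .
qed

text \<open>Every row of the operator is a product vector. A vanishing trace makes each square
  vanish, so each row solves the equations of \<open>product_in_ghz_kernel\<close> and is
  zero.\<close>

lemma product_op_eq_0:
  assumes s: "s = 1 \<or> s = - 1"
    and A: "A \<in> carrier_mat a 2" and B: "B \<in> carrier_mat b 2" and C: "C \<in> carrier_mat c 2"
    and tr0: "tr (kron A (kron B C) * ghz_mixture s * mat_adjoint (kron A (kron B C))) = 0"
  shows "kron A (kron B C) = 0\<^sub>m (a * (b * c)) 8"
proof (rule eq_matI)
  let ?L = "kron A (kron B C)"
  have L: "?L \<in> carrier_mat (a * (b * c)) 8"
    using kron_carrier[OF A kron_carrier[OF B C]] by simp
  fix r j assume "r < dim_row (0\<^sub>m (a * (b * c)) 8)" "j < dim_col (0\<^sub>m (a * (b * c)) 8)"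
  then have r: "r < a * (b * c)" and j: "j < 8" by auto
  let ?g = "\<lambda>r k. ?L $$ (r, k) + s * ghz_sign k * ?L $$ (r, 7 - k)"
  let ?f = "\<lambda>r. (\<Sum>k<4. ?g r k * cnj (?g r k)) / 8"
  have "(\<Sum>r<a * (b * c). ?f r) = 0"
    using tr0 unfolding tr_conj_ghz_mixture[OF s L] .
  then have "\<forall>r \<in> {..<a * (b * c)}. ?f r = 0"
    by (subst (asm) sum_nonneg_eq_0_iff[OF finite_lessThan ghz_form_nonneg])
  then have "(\<Sum>k<4. ?g r k * cnj (?g r k)) = 0" using r by simp
  then have "\<forall>k \<in> {..<4}. ?g r k * cnj (?g r k) = 0"
    by (subst (asm) sum_nonneg_eq_0_iff[OF finite_lessThan mult_cnj_nonneg])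
  then have eq: "?g r k = 0" if "k < 4" for k
    using that by (metis complex_cnj_zero_iff lessThan_iff mult_eq_0_iff)
  let ?x = "\<lambda>i. A $$ (r div (b * c), i)"
  let ?y = "\<lambda>i. B $$ (r mod (b * c) div c, i)"
  let ?z = "\<lambda>i. C $$ (r mod (b * c) mod c, i)"
  \<comment> \<open>The three binary digits of \<open>k\<close> select the entries of the factors,
    the first party having the most significant digit.\<close>
  have entry: "?L $$ (r, k) = ?x (k div 4) * (?y (k mod 4 div 2) * ?z (k mod 4 mod 2))"
    if "k < 8" for k
    using r that A B C less_mult_divmod[OF r] less_mult_divmod[of k 2 4]
    by (simp add: kron_index)
  \<comment> \<open>The values \<open>k = 0, 1, 2, 3\<close> give the four equations in order;
    \<open>ghz_sign 3\<close> accounts for the minus sign in the last one.\<close>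
  have "(?x 0 = 0 \<and> ?x 1 = 0) \<or> (?y 0 = 0 \<and> ?y 1 = 0) \<or> (?z 0 = 0 \<and> ?z 1 = 0)"
    by (rule product_in_ghz_kernel[of s])
      (use s eq[of 0] eq[of 1] eq[of 2] eq[of 3] in \<open>auto simp: entry ghz_sign_def mult_ac\<close>)
  moreover have "j div 4 = 0 \<or> j div 4 = 1" "j mod 4 div 2 = 0 \<or> j mod 4 div 2 = 1"
    "j mod 4 mod 2 = 0 \<or> j mod 4 mod 2 = 1"
    using j by auto
  ultimately show "?L $$ (r, j) = 0\<^sub>m (a * (b * c)) 8 $$ (r, j)"
    unfolding entry[OF j] using r j by auto
qed (use A B C in auto)

section \<open>Protocols acting by product operators\<close>

text \<open>A local operator multiplies just one of the three factors, so product form survives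
  every measurement. The input dimensions \<open>p\<close>, \<open>q\<close>, \<open>r\<close> are
  kept while the current ones may change.\<close>

lemma local_op_mult_product:
  assumes A: "A \<in> carrier_mat a p" and B: "B \<in> carrier_mat b q" and C: "C \<in> carrier_mat c r"
    and k: "k < 3" and K: "dim_col K = [a, b, c] ! k"
  shows "\<exists>A' B' C' a' b' c'. [a, b, c][k := dim_row K] = [a', b', c'] \<and>
    A' \<in> carrier_mat a' p \<and> B' \<in> carrier_mat b' q \<and> C' \<in> carrier_mat c' r \<and>
    local_op [a, b, c] k K * kron A (kron B C) = kron A' (kron B' C')"
proof -
  consider "k = 0" | "k = 1" | "k = 2" using k by linarith
  then show ?thesis
  proof cases
    case 1
    then have K': "K \<in> carrier_mat (dim_row K) a" using K by auto
    have "local_op [a, b, c] k K * kron A (kron B C) = kron K (1\<^sub>m (b * c)) * kron A (kron B C)"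
      using 1 by (simp add: local_op_def kron_one_left[unfolded One_nat_def])
    also have "\<dots> = kron (K * A) (1\<^sub>m (b * c) * kron B C)"
      by (rule kron_mult[OF K' A one_carrier_mat kron_carrier[OF B C]])
    also have "1\<^sub>m (b * c) * kron B C = kron B C"
      by (rule left_mult_one_mat[OF kron_carrier[OF B C]])
    finally show ?thesis using 1 mult_carrier_mat[OF K' A] B C by auto
  next
    case 2
    then have K': "K \<in> carrier_mat (dim_row K) b" using K by auto
    have "local_op [a, b, c] k K * kron A (kron B C) =
        kron (1\<^sub>m a) (kron K (1\<^sub>m c)) * kron A (kron B C)"
      using 2 by (simp add: local_op_def)
    also have "\<dots> = kron (1\<^sub>m a * A) (kron K (1\<^sub>m c) * kron B C)"
      by (rule kron_mult[OF one_carrier_mat A kron_carrier[OF K' one_carrier_mat] kron_carrier[OF B C]])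
    also have "\<dots> = kron A (kron (K * B) C)"
      using A C by (simp add: kron_mult[OF K' B one_carrier_mat C])
    finally show ?thesis using 2 mult_carrier_mat[OF K' B] A C by auto
  next
    case 3
    then have K': "K \<in> carrier_mat (dim_row K) c" using K by auto
    \<comment> \<open>Regrouping the first two factors lets \<open>kron_mult\<close> apply with
      \<open>K\<close> in the second place.\<close>
    have "local_op [a, b, c] k K * kron A (kron B C) = kron (1\<^sub>m (a * b)) K * kron (kron A B) C"
      using 3 by (simp add: local_op_def kron_assoc kron_one_right[unfolded One_nat_def])
    also have "\<dots> = kron (1\<^sub>m (a * b) * kron A B) (K * C)"
      by (rule kron_mult[OF one_carrier_mat kron_carrier[OF A B] K' C])
    also have "\<dots> = kron A (kron B (K * C))"
      using left_mult_one_mat[OF kron_carrier[OF A B]] by (simp add: kron_assoc)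
    finally show ?thesis using 3 mult_carrier_mat[OF K' C] A B by auto
  qed
qed

text \<open>Collects the operators along a branch into a single one.\<close>

lemma conj_mult:
  fixes L N \<rho> :: "complex mat"
  assumes L: "L \<in> carrier_mat l m" and N: "N \<in> carrier_mat m n" and \<rho>: "\<rho> \<in> carrier_mat n n"
  shows "L * (N * \<rho> * mat_adjoint N) * mat_adjoint L = L * N * \<rho> * mat_adjoint (L * N)"
proof -
  have N': "mat_adjoint N \<in> carrier_mat n m" and L': "mat_adjoint L \<in> carrier_mat m l"
    using L N by auto
  have N\<rho>: "N * \<rho> \<in> carrier_mat m n" using N \<rho> by simp
  have "L * N * \<rho> * (mat_adjoint N * mat_adjoint L) = L * (N * \<rho>) * (mat_adjoint N * mat_adjoint L)"
    using assoc_mult_mat[OF L N \<rho>] by simp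
  also have "\<dots> = L * (N * \<rho>) * mat_adjoint N * mat_adjoint L"
    using assoc_mult_mat[OF mult_carrier_mat[OF L N\<rho>] N' L'] by simp
  also have "L * (N * \<rho>) * mat_adjoint N = L * (N * \<rho> * mat_adjoint N)"
    by (rule assoc_mult_mat[OF L N\<rho> N'])
  finally show ?thesis by (simp add: mat_adjoint_mult[OF L N])
qed

text \<open>Induction on the protocol, where \<open>N\<close> is the product operator accumulated so
  far. Branch probabilities on the mixture are nonnegative, so all of them vanish. At a leaf with
  output \<open>x\<close> this gives \<open>N = 0\<close> by \<open>product_op_eq_0\<close>, hence
  probability 0 on \<open>\<tau>\<close> too.\<close>

lemma outcome_prob_product_eq_0:
  assumes s: "s = 1 \<or> s = - 1" and \<tau>: "\<tau> \<in> carrier_mat 8 8"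
  shows "A \<in> carrier_mat a 2 \<Longrightarrow> B \<in> carrier_mat b 2 \<Longrightarrow> C \<in> carrier_mat c 2 \<Longrightarrow>
    valid_protocol P [a, b, c] \<Longrightarrow> N = kron A (kron B C) \<Longrightarrow>
    outcome_prob P [a, b, c] (N * ghz_mixture s * mat_adjoint N) x = 0 \<Longrightarrow>
    outcome_prob P [a, b, c] (N * \<tau> * mat_adjoint N) x = 0"
proof (induction P arbitrary: A B C a b c N)
  case (Output y)
  show ?case
  proof (cases "x = y")
    case True
    then have N: "N = 0\<^sub>m (a * (b * c)) 8"
      using product_op_eq_0[OF s Output.prems(1-3)] Output.prems(5,6) by simp
    then have "N * \<tau> * mat_adjoint N = 0\<^sub>m (a * (b * c)) (a * (b * c))"
      using \<tau> by simp
    then show ?thesis by (simp add: tr_def)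
  qed simp
next
  case (Measure k Ks nxt)
  let ?\<rho> = "ghz_mixture s"
  let ?L = "\<lambda>i. local_op [a, b, c] k (Ks ! i)"
  let ?ds = "\<lambda>i. [a, b, c][k := dim_row (Ks ! i)]"
  have N: "N \<in> carrier_mat (prod_list [a, b, c]) 8"
    using kron_carrier[OF Measure.prems(1) kron_carrier[OF Measure.prems(2,3)]] Measure.prems(5) by simp
  have k: "k < length [a, b, c]" using Measure.prems(4) by simp
  have col: "dim_col (Ks ! i) = [a, b, c] ! k" if "i < length Ks" for i
    using Measure.prems(4) that by (simp add: kraus_familyD)
  have L: "?L i \<in> carrier_mat (prod_list (?ds i)) (prod_list [a, b, c])" if "i < length Ks" for i
    by (rule local_op_carrier[OF k col[OF that]])
  have pos: "positive_op 8 ?\<rho>"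
    using mixed_state_ghz_mixture[OF s] by (simp add: mixed_state_def density_op_def)
  have zero: "outcome_prob (nxt i) (?ds i) (?L i * (N * ?\<rho> * mat_adjoint N) * mat_adjoint (?L i)) x = 0"
    if i: "i < length Ks" for i
  proof -
    have "0 \<le> outcome_prob (nxt i) (?ds i) (?L i * (N * ?\<rho> * mat_adjoint N) * mat_adjoint (?L i)) x"
      if "i < length Ks" for i
      using Measure.prems(4) that
      by (intro outcome_prob_nonneg positive_op_conj[OF positive_op_conj[OF pos N] L]) auto
    then show ?thesis
      using Measure.prems(6) i unfolding outcome_prob.simps
      by (subst (asm) sum_nonneg_eq_0_iff) auto
  qed
  show ?case unfolding outcome_prob.simps
  proof (rule sum.neutral, rule ballI)
    fix i assume "i \<in> {..<length Ks}"
    then have i: "i < length Ks" by simp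
    obtain A' B' C' a' b' c' where ds: "?ds i = [a', b', c']"
      and ABC: "A' \<in> carrier_mat a' 2" "B' \<in> carrier_mat b' 2" "C' \<in> carrier_mat c' 2"
      and LN: "?L i * N = kron A' (kron B' C')"
      using local_op_mult_product[OF Measure.prems(1-3) _ col[OF i]] k Measure.prems(5) by auto
    have "valid_protocol (nxt i) [a', b', c']"
      using Measure.prems(4) i unfolding ds[symmetric] by simp
    from Measure.IH[OF _ ABC this LN] zero[OF i]
    show "outcome_prob (nxt i) (?ds i) (?L i * (N * \<tau> * mat_adjoint N) * mat_adjoint (?L i)) x = 0"
      unfolding ds conj_mult[OF L[OF i] N ghz_mixture_carrier] conj_mult[OF L[OF i] N \<tau>] by simp
  qed
qed

text \<open>A protocol starts with the identity, which is a product of three identities.\<close>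

lemma outcome_prob_ghz_mixture_eq_0:
  assumes "s = 1 \<or> s = - 1" "valid_protocol P [2, 2, 2]"
    "outcome_prob P [2, 2, 2] (ghz_mixture s) x = 0" "\<tau> \<in> carrier_mat 8 8"
  shows "outcome_prob P [2, 2, 2] \<tau> x = 0"
proof -
  have one: "kron (1\<^sub>m 2) (kron (1\<^sub>m 2) (1\<^sub>m 2)) = 1\<^sub>m 8"
    by (simp add: kron_one_one)
  have adj: "mat_adjoint (1\<^sub>m 8) = (1\<^sub>m 8 :: complex mat)"
    by (rule eq_matI) auto
  have id: "1\<^sub>m 8 * \<rho> * mat_adjoint (1\<^sub>m 8) = \<rho>" if "\<rho> \<in> carrier_mat 8 8" for \<rho> :: "complex mat"
    using that by (simp add: adj)
  show ?thesis
    using outcome_prob_product_eq_0[OF assms(1,4) one_carrier_mat one_carrier_mat one_carrier_mat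
        assms(2) refl, of x] assms(3)
    unfolding one id[OF ghz_mixture_carrier] id[OF assms(4)] by simp
qed

text \<open>For the question about the first mixture, \<open>Yes\<close> has probability 0 on the
  second one and \<open>No\<close> on the first. Both outcomes then have probability 0 on both
  states, so a conclusive answer never occurs.\<close>

lemma not_conclusive_LRA_ghz_mixtures:
  "\<not> conclusive_LRA [2, 2, 2] {ghz_mixture 1, ghz_mixture (- 1)}"
proof
  let ?\<rho> = "ghz_mixture 1" and ?\<sigma> = "ghz_mixture (- 1)"
  assume "conclusive_LRA [2, 2, 2] {?\<rho>, ?\<sigma>}"
  then have "conclusively_answerable [2, 2, 2] {?\<rho>, ?\<sigma>} ?\<rho>"
    by (simp add: conclusive_LRA_def)
  then obtain M where M: "answer_povm [2, 2, 2] M" "locc_implementable [2, 2, 2] M"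
    and yes: "\<forall>\<tau> \<in> {?\<rho>, ?\<sigma>} - {?\<rho>}. tr (M Yes * \<tau>) = 0" and no: "tr (M No * ?\<rho>) = 0"
    and gt: "1 / of_nat (card {?\<rho>, ?\<sigma>}) * (\<Sum>\<tau> \<in> {?\<rho>, ?\<sigma>}. tr ((M Yes + M No) * \<tau>)) > 0"
    unfolding conclusively_answerable_def by blast
  obtain P where P: "valid_protocol P [2, 2, 2]"
    and prob: "\<And>\<tau> x. density_op [2, 2, 2] \<tau> \<Longrightarrow> outcome_prob P [2, 2, 2] \<tau> x = tr (M x * \<tau>)"
    using M(2) unfolding locc_implementable_def by blast
  have dens: "density_op [2, 2, 2] ?\<rho>" "density_op [2, 2, 2] ?\<sigma>"
    using mixed_state_ghz_mixture by (auto simp: mixed_state_def)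
  \<comment> \<open>The condition on \<open>Yes\<close> concerns only states different from the
    first mixture, so the two have to be told apart; an antidiagonal entry does this.\<close>
  have "?\<rho> $$ (0, 7) \<noteq> ?\<sigma> $$ (0, 7)" by (simp add: ghz_mixture_def ghz_sign_def)
  then have "?\<rho> \<noteq> ?\<sigma>" by metis
  then have "tr (M Yes * ?\<sigma>) = 0" using yes by auto
  then have "outcome_prob P [2, 2, 2] ?\<sigma> Yes = 0" "outcome_prob P [2, 2, 2] ?\<rho> No = 0"
    using prob dens no by auto
  then have "outcome_prob P [2, 2, 2] \<tau> Yes = 0" "outcome_prob P [2, 2, 2] \<tau> No = 0"
    if "\<tau> \<in> carrier_mat 8 8" for \<tau>
    using outcome_prob_ghz_mixture_eq_0[OF _ P _ that] by blast+
  then have zero: "tr (M Yes * \<tau>) = 0" "tr (M No * \<tau>) = 0" if "\<tau> \<in> {?\<rho>, ?\<sigma>}" for \<tau>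
    using prob dens that ghz_mixture_carrier by (metis insertE singletonD)+
  have Mc: "M x \<in> carrier_mat 8 8" for x
    using M(1) by (simp add: answer_povm_def positive_op_def)
  have "tr ((M Yes + M No) * \<tau>) = 0" if "\<tau> \<in> {?\<rho>, ?\<sigma>}" for \<tau>
  proof -
    have "\<tau> \<in> carrier_mat 8 8" using that by auto
    then show ?thesis
      using zero[OF that] by (simp add: tr_add_mult[OF Mc Mc])
  qed
  then have "(\<Sum>\<tau> \<in> {?\<rho>, ?\<sigma>}. tr ((M Yes + M No) * \<tau>)) = 0"
    by (intro sum.neutral) blast
  then show False using gt by simp
qed

theorem proposition3:
  shows "(\<forall>ds S. multipartite ds \<and> finite S \<and> (\<forall>\<rho> \<in> S. pure_state ds \<rho>) \<and> mutually_orthogonal S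
            \<longrightarrow> conclusive_LRA ds S) \<and>
         (\<exists>ds S. multipartite ds \<and> finite S \<and> (\<forall>\<rho> \<in> S. mixed_state ds \<rho>) \<and> mutually_orthogonal S
            \<and> \<not> conclusive_LRA ds S)"
proof (intro conjI exI)
  show "\<forall>ds S. multipartite ds \<and> finite S \<and> (\<forall>\<rho> \<in> S. pure_state ds \<rho>) \<and> mutually_orthogonal S
      \<longrightarrow> conclusive_LRA ds S"
    using conclusive_LRA_pure_states by blast
  let ?S = "{ghz_mixture 1, ghz_mixture (- 1)}"
  show "multipartite [2, 2, 2]" by (simp add: multipartite_def)
  show "finite ?S" by simp
  show "\<forall>\<rho> \<in> ?S. mixed_state [2, 2, 2] \<rho>"
    using mixed_state_ghz_mixture by blast
  show "mutually_orthogonal ?S"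
    using tr_ghz_mixture_mult[of 1] tr_ghz_mixture_mult[of "- 1"] by (auto simp: mutually_orthogonal_def)
  show "\<not> conclusive_LRA [2, 2, 2] ?S" by (rule not_conclusive_LRA_ghz_mixtures)
qed

end
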